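(* Let $I\subset\mathbb{R}$ be an interval, let $\alpha_\hbar$ be a partial bijection of $I$ with classical limit, let $\mathrm{Cyl}(I,\alpha_\hbar)=\tilde{\mathcal F}(I)\rtimes_{\alpha_\hbar}\mathbb{Z}$ be the associated $\alpha$-fuzzy cylinder, and let $x_0$ be a point in $I$. Write $x_n=\alpha_\hbar^n(x_0)$ whenever $x_0\in I_{-n}=\mathrm{dom}(\alpha_\hbar^n)$. Then there are integers $n_-\le 0$ (which can be $-\infty$) and $n_+\ge 0$ (which can be $+\infty$), namely such that $\alpha_\hbar^n(x_0)$ is defined exactly for the integers $n$ with $n_-\le n\le n_+$, so that $$\tilde X=\{\alpha_\hbar^n(x_0)\mid n\in\mathbb{Z},\ x_0\in I_{-n}\}=\{x_n\mid n_-\le n\le n_+\}.$$ Let $\mathcal H$ be the Hilbert space with basis $\{|x_n\rangle \mid x_n\in\tilde X,\ n_-\le n\le n_+\}$ and let $$V|x_n\rangle=\begin{cases}|x_{n+1}\rangle,& n_-\le n<n_+,\\ 0,& n=n_+,\end{cases}\qquad V^*|x_n\rangle=\begin{cases}|x_{n-1}\rangle,& n_-<n\le n_+,\\ 0,& n=n_-,\end{cases}\qquad \pi(f)|x_n\rangle=f(x_n)|x_n\rangle$$ for $f\in\tilde{\mathcal F}(I)$. Then $$\sum_{n\in\mathbb{Z}}^{\text{finite}} f_n\delta_n\ \longmapsto\ \sum_{n\ge 1}^{\text{finite}}\pi(f_{-n})(V^* )^n+\pi(f_0)+\sum_{n\ge1}^{\text{finite}}\pi(f_n)V^n\qquad (f_n\in\tilde{\mathcal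 F}(I_n))$$ is a $*$-representation of $\mathrm{Cyl}(I,\alpha_\hbar)$ on $\mathcal H$.
   Context: A partial bijection of a set $X$ is a bijection $\alpha:\mathrm{dom}(\alpha)\to\mathrm{ran}(\alpha)$ between subsets of $X$. Partial bijections are composed on the largest possible domain: $\mathrm{dom}(\beta\alpha)=\alpha^{-1}(\mathrm{ran}(\alpha)\cap\mathrm{dom}(\beta))$. Put $\alpha^0=\mathrm{id}$, $\alpha^{-1}$ the inverse, $\alpha^{-n}=(\alpha^{-1})^n$, and $I_n=\mathrm{ran}(\alpha^n)$, so $\alpha^n:I_{-n}\to I_n$, $I_0=I$. $I_{\pm1}$ are subintervals of $I$. A family $\alpha_\hbar$ of continuous partial bijections of $I$ (indexed by $\hbar$ in a set of non-negative reals containing $0$) has classical limit if $\alpha_0=\mathrm{id}_I$ and $\alpha_\hbar\to\mathrm{id}_I$ pointwise as $\hbar\to0$. In the claim $\hbar$ is fixed; below $\alpha=\alpha_\hbar$. $\tilde{\mathcal F}(I)$ is one of $\mathcal F(I)$ (all complex-valued functions on $I$), $C(I)$ (continuous ones), $C_0(I)$ (continuous ones vanishing at infinity). For $Y\subset I$, $\tilde{\mathcal F}(Y)$ is the ideal of all $f\in\tilde{\mathcal F}(I)$ vanishing outside $Y$. $S=S_\alpha(\mathbb{Z})$ is the inverse semigroup of partial bijections of $I$ generated under composition by all $\alpha^n$, $n\in\mathbb{Z}$. For $s\in S$ write $s^*=s^{-1}$, $I_s=\mathrm{ran}(s)$, $I_{s^*}=\mathrm{dom}(s)$, and let $\hat\alpha_s:\tilde{\mathcal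 F}(I_{s^*})\to\tilde{\mathcal F}(I_s)$ be $\hat\alpha_s(f)=f\circ s^{-1}$ on $I_s$ and $0$ outside $I_s$ (when $\tilde{\mathcal F}$ is $C$ or $C_0$ it is a standing assumption that these maps carry the ideals onto each other). Let $L$ be the space of finitely supported maps $S\to\tilde{\mathcal F}(I)$, $s\mapsto a_s\in\tilde{\mathcal F}(I_s)$, written $\sum a_s\delta_s$, with $a_s\delta_s\cdot a_t\delta_t=\hat\alpha_s(\hat\alpha_{s^*}(a_s)a_t)\delta_{st}$ and $(a_s\delta_s)^*=\hat\alpha_{s^*}(\overline{a_s})\delta_{s^*}$. Let $N$ be the ideal generated by all $a\delta_s-a\delta_t$ with $a\in\tilde{\mathcal F}(I_s)$ and $s\le t$ (i.e. $s=qt$ for an idempotent $q\in S$). Then $\mathrm{Cyl}(I,\alpha)=\tilde{\mathcal F}(I)\rtimes_\alpha\mathbb{Z}:=L/N$, and $f\delta_n$ denotes the class of $f\delta_{\alpha^n}$ for $f\in\tilde{\mathcal F}(I_n)$; every element is a finite sum $\sum_n f_n\delta_n$. The basis vectors of $\mathcal H$ are orthonormal and indexed by the points of $\tilde X$ (a point reached for several $n$ is counted once); $\mathcal H$ is the space of square summable functions on $\tilde X$. A $*$-representation on $\mathcal H$ is a $*$-homomorphism into $B(\mathcal H)$, the algebra of bounded linear operators on $\mathcal H$.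
   Formalization: When F̃(I) is F(I) or C(I), every f in F̃(I) is assumed bounded on the orbit X̃; otherwise π(f) is not in B(H) (e.g. I=ℝ, α_ħ(x)=x+ħ with ħ>0, f(x)=x) and the claim fails. *)

theory Defs
  imports
    "HOL-Analysis.Analysis"
    "HOL-Library.Extended"
    "HOL-Library.Function_Algebras"
    "HOL-Library.Poly_Mapping"
begin

section \<open>Partial bijections of an interval\<close>

text \<open>
  Partial maps are rendered as \<open>real \<rightharpoonup> real\<close>; the library composition \<open>\<circ>\<^sub>m\<close> is the
  composition on the largest possible domain.
\<close>

definition partial_bij :: "real set \<Rightarrow> (real \<rightharpoonup> real) \<Rightarrow> bool" where
  "partial_bij I a \<longleftrightarrow> dom a \<subseteq> I \<and> ran a \<subseteq> I \<and> inj_on a (dom a)"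

definition pid :: "real set \<Rightarrow> (real \<rightharpoonup> real)" where
  "pid I = Some |` I"

text \<open>The choice below is unambiguous because it is only used for partial bijections.\<close>

definition pinv :: "(real \<rightharpoonup> real) \<Rightarrow> (real \<rightharpoonup> real)" where
  "pinv a = (\<lambda>y. if y \<in> ran a then Some (SOME x. a x = Some y) else None)"

definition ppow :: "real set \<Rightarrow> (real \<rightharpoonup> real) \<Rightarrow> int \<Rightarrow> (real \<rightharpoonup> real)" where
  "ppow I a n =
     (if 0 \<le> n then ((\<lambda>s. a \<circ>\<^sub>m s) ^^ nat n) (pid I)
      else ((\<lambda>s. pinv a \<circ>\<^sub>m s) ^^ nat (- n)) (pid I))"

text \<open>
  A family of continuous partial bijections indexed by \<open>P\<close>. Since \<open>\<alpha> h x\<close> need not be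
  defined for every \<open>h\<close>, the pointwise limit at \<open>x\<close> is taken along those \<open>h\<close> for which it is.
  This is implied by the version that also asks \<open>x\<close> to lie in the domain for all small \<open>h\<close>
  (which fails at an end point of \<open>I\<close> for translations of a compact interval).
\<close>

definition has_classical_limit ::
    "real set \<Rightarrow> real set \<Rightarrow> (real \<Rightarrow> (real \<rightharpoonup> real)) \<Rightarrow> bool" where
  "has_classical_limit I P \<alpha> \<longleftrightarrow>
     P \<subseteq> {0..} \<and> 0 \<in> P \<and>
     (\<forall>h\<in>P. partial_bij I (\<alpha> h) \<and> continuous_on (dom (\<alpha> h)) (\<lambda>x. the (\<alpha> h x))) \<and>
     \<alpha> 0 = pid I \<and>
     (\<forall>x\<in>I. ((\<lambda>h. the (\<alpha> h x)) \<longlongrightarrow> x) (at 0 within {h\<in>P. x \<in> dom (\<alpha> h)}))"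

inductive_set gen_semigroup :: "real set \<Rightarrow> (real \<rightharpoonup> real) \<Rightarrow> (real \<rightharpoonup> real) set"
  for I :: "real set" and a :: "real \<rightharpoonup> real" where
  power: "ppow I a n \<in> gen_semigroup I a"
| comp: "s \<in> gen_semigroup I a \<Longrightarrow> t \<in> gen_semigroup I a \<Longrightarrow> s \<circ>\<^sub>m t \<in> gen_semigroup I a"

definition semigroup_le ::
    "(real \<rightharpoonup> real) set \<Rightarrow> (real \<rightharpoonup> real) \<Rightarrow> (real \<rightharpoonup> real) \<Rightarrow> bool" where
  "semigroup_le S s t \<longleftrightarrow> (\<exists>q\<in>S. q \<circ>\<^sub>m q = q \<and> s = q \<circ>\<^sub>m t)"

section \<open>Function algebras\<close>

text \<open>
  A function on \<open>I\<close> is represented by its extension by \<open>0\<close> to the real line, so that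
  the pointwise operations on \<open>real \<Rightarrow> complex\<close> are those of functions on \<open>I\<close>.
\<close>

definition all_funs :: "real set \<Rightarrow> (real \<Rightarrow> complex) set" where
  "all_funs I = {f. \<forall>x. x \<notin> I \<longrightarrow> f x = 0}"

definition cont_funs :: "real set \<Rightarrow> (real \<Rightarrow> complex) set" where
  "cont_funs I = {f \<in> all_funs I. continuous_on I f}"

definition C0_funs :: "real set \<Rightarrow> (real \<Rightarrow> complex) set" where
  "C0_funs I = {f \<in> cont_funs I. \<forall>\<epsilon>>0. \<exists>K\<subseteq>I. compact K \<and> (\<forall>x\<in>I - K. cmod (f x) < \<epsilon>)}"

definition ideal_on :: "(real \<Rightarrow> complex) set \<Rightarrow> real set \<Rightarrow> (real \<Rightarrow> complex) set" where
  "ideal_on F Y = {f \<in> F. \<forall>x. x \<notin> Y \<longrightarrow> f x = 0}"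

definition hat :: "(real \<rightharpoonup> real) \<Rightarrow> (real \<Rightarrow> complex) \<Rightarrow> (real \<Rightarrow> complex)" where
  "hat s f = (\<lambda>x. case pinv s x of Some y \<Rightarrow> f y | None \<Rightarrow> 0)"

section \<open>The fuzzy cylinder\<close>

text \<open>\<open>Poly_Mapping.single s f\<close> is the element written \<open>f \<delta>\<^sub>s\<close>.\<close>

type_synonym lelem = "(real \<rightharpoonup> real) \<Rightarrow>\<^sub>0 (real \<Rightarrow> complex)"

definition L_carrier :: "real set \<Rightarrow> (real \<rightharpoonup> real) \<Rightarrow> (real \<Rightarrow> complex) set \<Rightarrow> lelem set" where
  "L_carrier I a F =
     {A. Poly_Mapping.keys A \<subseteq> gen_semigroup I a \<and>
         (\<forall>s\<in>Poly_Mapping.keys A. Poly_Mapping.lookup A s \<in> ideal_on F (ran s))}"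

definition L_scale :: "complex \<Rightarrow> lelem \<Rightarrow> lelem" where
  "L_scale c A = Poly_Mapping.map (\<lambda>f x. c * f x) A"

definition L_mult :: "lelem \<Rightarrow> lelem \<Rightarrow> lelem" where
  "L_mult A B =
     (\<Sum>s\<in>Poly_Mapping.keys A. \<Sum>t\<in>Poly_Mapping.keys B.
        Poly_Mapping.single (s \<circ>\<^sub>m t)
          (hat s (hat (pinv s) (Poly_Mapping.lookup A s) * Poly_Mapping.lookup B t)))"

definition L_star :: "lelem \<Rightarrow> lelem" where
  "L_star A =
     (\<Sum>s\<in>Poly_Mapping.keys A.
        Poly_Mapping.single (pinv s) (hat (pinv s) (\<lambda>x. cnj (Poly_Mapping.lookup A s x))))"

definition L_ideal ::
    "real set \<Rightarrow> (real \<rightharpoonup> real) \<Rightarrow> (real \<Rightarrow> complex) set \<Rightarrow> lelem set \<Rightarrow> bool" where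
  "L_ideal I a F J \<longleftrightarrow>
     J \<subseteq> L_carrier I a F \<and> 0 \<in> J \<and>
     (\<forall>A\<in>J. \<forall>B\<in>J. A + B \<in> J) \<and>
     (\<forall>c. \<forall>A\<in>J. L_scale c A \<in> J) \<and>
     (\<forall>A\<in>J. \<forall>B\<in>L_carrier I a F. L_mult A B \<in> J \<and> L_mult B A \<in> J)"

definition N_gens :: "real set \<Rightarrow> (real \<rightharpoonup> real) \<Rightarrow> (real \<Rightarrow> complex) set \<Rightarrow> lelem set" where
  "N_gens I a F =
     {Poly_Mapping.single s f - Poly_Mapping.single t f | s t f.
        s \<in> gen_semigroup I a \<and> t \<in> gen_semigroup I a \<and>
        semigroup_le (gen_semigroup I a) s t \<and> f \<in> ideal_on F (ran s)}"

definition N_ideal :: "real set \<Rightarrow> (real \<rightharpoonup> real) \<Rightarrow> (real \<Rightarrow> complex) set \<Rightarrow> lelem set" where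
  "N_ideal I a F = \<Inter> {J. L_ideal I a F J \<and> N_gens I a F \<subseteq> J}"

definition L_class ::
    "real set \<Rightarrow> (real \<rightharpoonup> real) \<Rightarrow> (real \<Rightarrow> complex) set \<Rightarrow> lelem \<Rightarrow> lelem set" where
  "L_class I a F A = (\<lambda>B. A + B) ` N_ideal I a F"

definition Cyl :: "real set \<Rightarrow> (real \<rightharpoonup> real) \<Rightarrow> (real \<Rightarrow> complex) set \<Rightarrow> lelem set set" where
  "Cyl I a F = L_class I a F ` L_carrier I a F"

text \<open>
  Operations on the quotient, as unions over representatives: since the class obtained does
  not depend on the representatives, each union is a single class.
\<close>

definition Cyl_add ::
    "real set \<Rightarrow> (real \<rightharpoonup> real) \<Rightarrow> (real \<Rightarrow> complex) set \<Rightarrow> lelem set \<Rightarrow> lelem set \<Rightarrow> lelem set" where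
  "Cyl_add I a F c d = (\<Union>A\<in>c. \<Union>B\<in>d. L_class I a F (A + B))"

definition Cyl_scale ::
    "real set \<Rightarrow> (real \<rightharpoonup> real) \<Rightarrow> (real \<Rightarrow> complex) set \<Rightarrow> complex \<Rightarrow> lelem set \<Rightarrow> lelem set" where
  "Cyl_scale I a F z c = (\<Union>A\<in>c. L_class I a F (L_scale z A))"

definition Cyl_mult ::
    "real set \<Rightarrow> (real \<rightharpoonup> real) \<Rightarrow> (real \<Rightarrow> complex) set \<Rightarrow> lelem set \<Rightarrow> lelem set \<Rightarrow> lelem set" where
  "Cyl_mult I a F c d = (\<Union>A\<in>c. \<Union>B\<in>d. L_class I a F (L_mult A B))"

definition Cyl_star ::
    "real set \<Rightarrow> (real \<rightharpoonup> real) \<Rightarrow> (real \<Rightarrow> complex) set \<Rightarrow> lelem set \<Rightarrow> lelem set" where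
  "Cyl_star I a F c = (\<Union>A\<in>c. L_class I a F (L_star A))"

text \<open>
  Finitely supported families \<open>(f\<^sub>n)\<close> with \<open>f\<^sub>n\<close> in the ideal of \<open>I\<^sub>n\<close>, and the element
  \<open>\<Sum>\<^sub>n f\<^sub>n \<delta>\<^sub>n\<close>. Different \<open>n\<close> may give the same partial bijection, whence a sum of singles.
\<close>

definition coeff_families ::
    "real set \<Rightarrow> (real \<rightharpoonup> real) \<Rightarrow> (real \<Rightarrow> complex) set \<Rightarrow> (int \<Rightarrow>\<^sub>0 (real \<Rightarrow> complex)) set" where
  "coeff_families I a F = {f. \<forall>n. Poly_Mapping.lookup f n \<in> ideal_on F (ran (ppow I a n))}"

definition Cyl_sum ::
    "real set \<Rightarrow> (real \<rightharpoonup> real) \<Rightarrow> (real \<Rightarrow> complex) set \<Rightarrow> (int \<Rightarrow>\<^sub>0 (real \<Rightarrow> complex)) \<Rightarrow> lelem set"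
  where
  "Cyl_sum I a F f =
     L_class I a F
       (\<Sum>n\<in>Poly_Mapping.keys f. Poly_Mapping.single (ppow I a n) (Poly_Mapping.lookup f n))"

section \<open>Square summable functions and bounded operators\<close>

definition orbit :: "real set \<Rightarrow> (real \<rightharpoonup> real) \<Rightarrow> real \<Rightarrow> real set" where
  "orbit I a x0 = {the (ppow I a n x0) | n. x0 \<in> dom (ppow I a n)}"

definition l2 :: "real set \<Rightarrow> (real \<Rightarrow> complex) set" where
  "l2 X = {\<psi>. (\<forall>x. x \<notin> X \<longrightarrow> \<psi> x = 0) \<and> (\<lambda>x. (cmod (\<psi> x))\<^sup>2) summable_on X}"

definition l2_inner :: "real set \<Rightarrow> (real \<Rightarrow> complex) \<Rightarrow> (real \<Rightarrow> complex) \<Rightarrow> complex" where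
  "l2_inner X \<phi> \<psi> = (\<Sum>\<^sub>\<infinity>x\<in>X. cnj (\<phi> x) * \<psi> x)"

definition l2_norm :: "real set \<Rightarrow> (real \<Rightarrow> complex) \<Rightarrow> real" where
  "l2_norm X \<psi> = sqrt (\<Sum>\<^sub>\<infinity>x\<in>X. (cmod (\<psi> x))\<^sup>2)"

definition ket :: "real \<Rightarrow> (real \<Rightarrow> complex)" where
  "ket x = indicator {x}"

text \<open>
  Note that \<open>ket x \<mapsto> f x \<cdot> ket x\<close> extends to a bounded operator on \<open>l2 X\<close> only if \<open>f\<close> is
  bounded on \<open>X\<close>, which can fail for arbitrary or continuous functions on an infinite orbit.
\<close>

definition bounded_operators :: "real set \<Rightarrow> ((real \<Rightarrow> complex) \<Rightarrow> (real \<Rightarrow> complex)) set" where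
  "bounded_operators X =
     {T \<in> l2 X \<rightarrow>\<^sub>E l2 X.
        (\<forall>\<phi>\<in>l2 X. \<forall>\<psi>\<in>l2 X. T (\<phi> + \<psi>) = T \<phi> + T \<psi>) \<and>
        (\<forall>c. \<forall>\<psi>\<in>l2 X. T (\<lambda>x. c * \<psi> x) = (\<lambda>x. c * T \<psi> x)) \<and>
        (\<exists>K. \<forall>\<psi>\<in>l2 X. l2_norm X (T \<psi>) \<le> K * l2_norm X \<psi>)}"

definition adjoint_operators ::
    "real set \<Rightarrow> ((real \<Rightarrow> complex) \<Rightarrow> (real \<Rightarrow> complex)) \<Rightarrow>
       ((real \<Rightarrow> complex) \<Rightarrow> (real \<Rightarrow> complex)) \<Rightarrow> bool" where
  "adjoint_operators X T T' \<longleftrightarrow>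
     (\<forall>\<phi>\<in>l2 X. \<forall>\<psi>\<in>l2 X. l2_inner X (T \<phi>) \<psi> = l2_inner X \<phi> (T' \<psi>))"

definition star_representation ::
    "real set \<Rightarrow> (real \<rightharpoonup> real) \<Rightarrow> (real \<Rightarrow> complex) set \<Rightarrow> real set \<Rightarrow>
       (lelem set \<Rightarrow> (real \<Rightarrow> complex) \<Rightarrow> (real \<Rightarrow> complex)) \<Rightarrow> bool" where
  "star_representation I a F X \<Phi> \<longleftrightarrow>
     \<Phi> \<in> Cyl I a F \<rightarrow> bounded_operators X \<and>
     (\<forall>c\<in>Cyl I a F. \<forall>d\<in>Cyl I a F. \<forall>\<psi>\<in>l2 X. \<Phi> (Cyl_add I a F c d) \<psi> = \<Phi> c \<psi> + \<Phi> d \<psi>) \<and>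
     (\<forall>z. \<forall>c\<in>Cyl I a F. \<forall>\<psi>\<in>l2 X. \<Phi> (Cyl_scale I a F z c) \<psi> = (\<lambda>x. z * \<Phi> c \<psi> x)) \<and>
     (\<forall>c\<in>Cyl I a F. \<forall>d\<in>Cyl I a F. \<forall>\<psi>\<in>l2 X. \<Phi> (Cyl_mult I a F c d) \<psi> = \<Phi> c (\<Phi> d \<psi>)) \<and>
     (\<forall>c\<in>Cyl I a F. adjoint_operators X (\<Phi> c) (\<Phi> (Cyl_star I a F c)))"

end

theory Submission
  imports Defs
begin

text \<open>
  A partial bijection \<open>s\<close> acts on functions by transport, \<open>\<psi> \<mapsto> \<psi> \<circ> s\<^sup>-\<^sup>1\<close> extended by
  \<open>0\<close>, and a function acts by pointwise multiplication. Transport is functorial and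
  multiplicative, which is exactly what makes \<open>f \<delta>\<^sub>s \<mapsto> f \<cdot> hat s\<close> a homomorphism
  (\<open>rep_mult\<close>), and this already holds for the action on all functions on the line. The order
  of the inverse semigroup is restriction of maps (\<open>semigroup_le_iff_map_le\<close>), and a function
  that lives on the range of \<open>s\<close> cannot distinguish transport along \<open>s\<close> from transport along an
  extension of \<open>s\<close>; so the action kills the ideal of relations (\<open>rep_N\<close>) and descends to the
  cylinder. The involution descends as well, because inverting maps preserves restriction
  (\<open>N_star\<close>).

  The orbit \<open>X\<close> brings in the Hilbert space. It is stable under the semigroup in both directions,
  so \<open>s\<close> matches the part of \<open>X\<close> in its domain with the part in its range. Substitution
  (\<open>has_sum_substitute\<close>) shows that transport along \<open>s\<close> is a contraction of the square summable
  functions on \<open>X\<close> whose adjoint is transport along the inverse of \<open>s\<close>. Functions of the algebra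
  are bounded on \<open>X\<close> and multiply boundedly, with the complex conjugate as adjoint. Therefore the
  action restricts to a \<open>*\<close>-representation by bounded operators.

  It remains to put it in coordinates. Each element of the semigroup restricts a power of the
  generator \<open>a\<close> (\<open>gen_semigroup_le_ppow\<close>), so the monomials \<open>f \<delta>\<^sub>n\<close> span the cylinder. With
  \<open>V\<close> the transport along \<open>a\<close>, functoriality turns \<open>f \<delta>\<^sub>n\<close> into \<open>\<pi>(f) V\<^sup>n\<close>, or into powers of
  the adjoint of \<open>V\<close> when \<open>n < 0\<close>. Transport moves the basis vector at a point to the one at its
  image, which is the shift along the trajectory of \<open>x\<^sub>0\<close>; since it refers to points and not to
  exponents, a periodic orbit is covered by the same formula. The exponents at which \<open>x\<^sub>0\<close>
  has an image form an interval because a power is defined only if all powers between it and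
  the zeroth are.
\<close>

section \<open>Partial injections and their inverses\<close>

abbreviation pinj :: "(real \<rightharpoonup> real) \<Rightarrow> bool" where
  "pinj s \<equiv> inj_on s (dom s)"

lemma pinj_D: "pinj s \<Longrightarrow> s x = Some z \<Longrightarrow> s y = Some z \<Longrightarrow> x = y"
  by (metis domI inj_onD)

lemma pinj_I: "(\<And>x y z. s x = Some z \<Longrightarrow> s y = Some z \<Longrightarrow> x = y) \<Longrightarrow> pinj s"
  by (auto simp: inj_on_def)

lemma pinv_eq_Some_iff: "pinj s \<Longrightarrow> pinv s y = Some x \<longleftrightarrow> s x = Some y"
  unfolding pinv_def ran_def
  by (auto dest: pinj_D intro: someI2 split: if_splits)

lemma map_eqI: "(\<And>x y. s x = Some y \<longleftrightarrow> t x = Some y) \<Longrightarrow> s = t"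
  by (metis ext option.exhaust)

lemma pinj_pinv: "pinj s \<Longrightarrow> pinj (pinv s)"
  by (rule pinj_I) (simp add: pinv_eq_Some_iff)

lemma pinv_pinv: "pinj s \<Longrightarrow> pinv (pinv s) = s"
  by (rule map_eqI) (simp add: pinv_eq_Some_iff pinj_pinv)

lemma pinj_comp: "pinj s \<Longrightarrow> pinj t \<Longrightarrow> pinj (s \<circ>\<^sub>m t)"
  by (rule pinj_I) (auto simp: map_comp_Some_iff dest: pinj_D)

lemma pinv_comp: "pinj s \<Longrightarrow> pinj t \<Longrightarrow> pinv (s \<circ>\<^sub>m t) = pinv t \<circ>\<^sub>m pinv s"
  by (rule map_eqI) (auto simp: map_comp_Some_iff pinv_eq_Some_iff pinj_comp)

lemma dom_pinv: "pinj s \<Longrightarrow> dom (pinv s) = ran s"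
  by (auto simp: dom_def ran_def pinv_eq_Some_iff)

lemma ran_pinv: "pinj s \<Longrightarrow> ran (pinv s) = dom s"
  by (auto simp: dom_def ran_def pinv_eq_Some_iff)

lemma map_leD: "s \<subseteq>\<^sub>m t \<Longrightarrow> s x = Some y \<Longrightarrow> t x = Some y"
  by (metis domI map_le_def)

lemma map_leI: "(\<And>x y. s x = Some y \<Longrightarrow> t x = Some y) \<Longrightarrow> s \<subseteq>\<^sub>m t"
  by (auto simp: map_le_def)

lemma pinj_mono: "pinj t \<Longrightarrow> s \<subseteq>\<^sub>m t \<Longrightarrow> pinj s"
  by (rule pinj_I) (blast dest: pinj_D map_leD)

lemma pinv_mono: "pinj t \<Longrightarrow> s \<subseteq>\<^sub>m t \<Longrightarrow> pinv s \<subseteq>\<^sub>m pinv t"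
  by (rule map_leI) (simp add: pinv_eq_Some_iff pinj_mono map_leD)

lemma comp_mono: "s \<subseteq>\<^sub>m s' \<Longrightarrow> t \<subseteq>\<^sub>m t' \<Longrightarrow> s \<circ>\<^sub>m t \<subseteq>\<^sub>m s' \<circ>\<^sub>m t'"
  by (rule map_leI) (auto simp: map_comp_Some_iff dest: map_leD)

lemma comp_assoc: "(s \<circ>\<^sub>m t) \<circ>\<^sub>m u = s \<circ>\<^sub>m (t \<circ>\<^sub>m u)"
  by (rule map_eqI) (auto simp: map_comp_Some_iff)

lemma comp_pinv_le: "pinj s \<Longrightarrow> s \<circ>\<^sub>m pinv s \<circ>\<^sub>m t \<subseteq>\<^sub>m t"
  by (rule map_leI) (auto simp: map_comp_Some_iff pinv_eq_Some_iff)

lemma pid_eq_Some_iff: "pid I x = Some y \<longleftrightarrow> x \<in> I \<and> y = x"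
  by (auto simp: pid_def restrict_map_def)

lemma pinj_pid: "pinj (pid I)"
  by (rule pinj_I) (simp add: pid_eq_Some_iff)

lemma pinv_pid: "pinv (pid I) = pid I"
  by (rule map_eqI) (auto simp: pinv_eq_Some_iff pinj_pid pid_eq_Some_iff)

text \<open>
  An idempotent partial injection is the identity of its domain: injectivity turns
  \<open>q (q x) = q x\<close> into \<open>q x = x\<close>.
\<close>

lemma idempotent_pinj_le_id: "pinj q \<Longrightarrow> q \<circ>\<^sub>m q = q \<Longrightarrow> q \<subseteq>\<^sub>m Some"
proof (rule map_leI)
  fix x y assume q: "pinj q" "q \<circ>\<^sub>m q = q" and xy: "q x = Some y"
  have "(q \<circ>\<^sub>m q) x = q y"
    using xy by simp
  thus "Some x = Some y"
    using q xy by (metis pinj_D)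
qed

section \<open>Powers of a partial bijection\<close>

lemma ppow_0: "ppow I a 0 = pid I"
  by (simp add: ppow_def)

lemma ppow_Suc: "0 \<le> n \<Longrightarrow> ppow I a (n + 1) = a \<circ>\<^sub>m ppow I a n"
  by (simp add: ppow_def nat_add_distrib)

lemma ppow_pred: "n \<le> 0 \<Longrightarrow> ppow I a (n - 1) = pinv a \<circ>\<^sub>m ppow I a n"
proof -
  assume "n \<le> 0"
  hence "nat (- (n - 1)) = Suc (nat (- n))" by simp
  thus ?thesis
    using \<open>n \<le> 0\<close> by (cases "n = 0") (simp_all add: ppow_def)
qed

lemma ppow_pinv: "pinj a \<Longrightarrow> ppow I (pinv a) n = ppow I a (- n)"
  by (auto simp: ppow_def pinv_pinv)

lemma partial_bij_pinv: "partial_bij I a \<Longrightarrow> partial_bij I (pinv a)"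
  using pinj_pinv[of a] by (simp add: partial_bij_def dom_pinv ran_pinv)

lemma ppow_ran_subset:
  assumes "partial_bij I a"
  shows "ran (ppow I a n) \<subseteq> I"
proof -
  have "ran a \<subseteq> I" "ran (pinv a) \<subseteq> I"
    using assms partial_bij_pinv[OF assms] by (simp_all add: partial_bij_def)
  thus ?thesis
    by (induction n rule: int_induct[where k = 0])
      (auto simp: ppow_0 ran_def pid_eq_Some_iff ppow_Suc ppow_pred map_comp_Some_iff)
qed

lemma pinj_ppow: "pinj a \<Longrightarrow> pinj (ppow I a n)"
  by (induction n rule: int_induct[where k = 0])
    (simp_all add: ppow_0 pinj_pid ppow_Suc ppow_pred pinj_comp pinj_pinv)

lemma pid_comp_ppow: "partial_bij I a \<Longrightarrow> pid I \<circ>\<^sub>m ppow I a n = ppow I a n"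
  using ppow_ran_subset[of I a n]
  by (intro map_eqI) (auto simp: map_comp_Some_iff pid_eq_Some_iff ran_def)

text \<open>
  No part of the domain is lost when the exponents have the same sign. This lets the last factor
  be split off instead of the first, as inverting a power requires.
\<close>

lemma ppow_add_nonneg:
  assumes a: "partial_bij I a" and m: "0 \<le> m" and n: "0 \<le> n"
  shows "ppow I a (m + n) = ppow I a m \<circ>\<^sub>m ppow I a n"
  using m
proof (induction m rule: int_ge_induct)
  case base
  show ?case by (simp add: ppow_0 pid_comp_ppow[OF a])
next
  case (step i)
  have "ppow I a (i + 1 + n) = a \<circ>\<^sub>m ppow I a (i + n)"
    using ppow_Suc[of "i + n" I a] step.hyps n by (simp add: add_ac)
  thus ?case
    using step by (simp add: ppow_Suc comp_assoc)
qed

lemma pinv_ppow_nonneg: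
  assumes a: "partial_bij I a" and n: "0 \<le> n"
  shows "pinv (ppow I a n) = ppow I a (- n)"
  using n
proof (induction n rule: int_ge_induct)
  case base
  show ?case by (simp add: ppow_0 pinv_pid)
next
  case (step i)
  have pa: "pinj a" using a by (simp add: partial_bij_def)
  have one: "ppow I (pinv a) 1 = pinv a"
    using ppow_Suc[of 0 I "pinv a"] partial_bij_pinv[OF a]
    by (intro map_eqI) (auto simp: ppow_0 map_comp_Some_iff pid_eq_Some_iff partial_bij_def)
  have "pinv (ppow I a (i + 1)) = ppow I (pinv a) i \<circ>\<^sub>m ppow I (pinv a) 1"
    unfolding one using step by (simp add: ppow_Suc pinv_comp pa pinj_ppow ppow_pinv)
  also have "\<dots> = ppow I (pinv a) (i + 1)"
    using ppow_add_nonneg[OF partial_bij_pinv[OF a] step.hyps, of 1] by simp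
  finally show ?case
    by (simp add: ppow_pinv pa)
qed

lemma pinv_ppow:
  assumes a: "partial_bij I a"
  shows "pinv (ppow I a n) = ppow I a (- n)"
proof (cases "0 \<le> n")
  case True
  thus ?thesis by (rule pinv_ppow_nonneg[OF a])
next
  case False
  have "pinj a" using a by (simp add: partial_bij_def)
  with False show ?thesis
    using pinv_ppow_nonneg[OF a, of "- n"] by (metis pinv_pinv pinj_ppow linorder_linear neg_0_le_iff_le minus_minus)
qed

text \<open>
  For negative \<open>n\<close> the left side undoes \<open>a\<close> and applies it again, which restricts the power to
  the points whose image lies in the range of \<open>a\<close>.
\<close>

lemma generator_comp_ppow_le:
  assumes a: "pinj a"
  shows "a \<circ>\<^sub>m ppow I a n \<subseteq>\<^sub>m ppow I a (n + 1)"
proof (cases "0 \<le> n")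
  case True
  thus ?thesis by (simp add: ppow_Suc)
next
  case False
  hence "ppow I a n = pinv a \<circ>\<^sub>m ppow I a (n + 1)"
    using ppow_pred[of "n + 1" I a] by simp
  thus ?thesis
    using comp_pinv_le[OF a] by (simp add: comp_assoc)
qed

lemma pinv_generator_comp_ppow_le:
  assumes a: "pinj a"
  shows "pinv a \<circ>\<^sub>m ppow I a n \<subseteq>\<^sub>m ppow I a (n - 1)"
  using generator_comp_ppow_le[OF pinj_pinv[OF a], of I "- n"]
  by (simp add: ppow_pinv a)

text \<open>
  Exponents add up to restriction only: for exponents of opposite sign the composition is
  defined on a smaller set in general.
\<close>

lemma ppow_comp_le:
  assumes a: "partial_bij I a"
  shows "ppow I a m \<circ>\<^sub>m ppow I a n \<subseteq>\<^sub>m ppow I a (m + n)"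
proof (induction m rule: int_induct[where k = 0])
  case base
  show ?case by (simp add: ppow_0 pid_comp_ppow[OF a])
next
  case (step1 i)
  have pa: "pinj a" using a by (simp add: partial_bij_def)
  have "a \<circ>\<^sub>m (ppow I a i \<circ>\<^sub>m ppow I a n) \<subseteq>\<^sub>m a \<circ>\<^sub>m ppow I a (i + n)"
    using step1.IH by (intro comp_mono) auto
  thus ?case
    using map_le_trans[OF _ generator_comp_ppow_le[OF pa, of I "i + n"]] step1.hyps
    by (simp add: ppow_Suc comp_assoc add.assoc add.commute[of n])
next
  case (step2 i)
  have pa: "pinj a" using a by (simp add: partial_bij_def)
  have "pinv a \<circ>\<^sub>m (ppow I a i \<circ>\<^sub>m ppow I a n) \<subseteq>\<^sub>m pinv a \<circ>\<^sub>m ppow I a (i + n)"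
    using step2.IH by (intro comp_mono) auto
  thus ?case
    using map_le_trans[OF _ pinv_generator_comp_ppow_le[OF pa, of I "i + n"]] step2.hyps
    by (simp add: ppow_pred comp_assoc diff_add_eq)
qed

section \<open>The inverse semigroup generated by the powers\<close>

lemma gen_semigroup_pinj:
  assumes a: "partial_bij I a" and s: "s \<in> gen_semigroup I a"
  shows "pinj s"
  using s by induction (use a in \<open>simp_all add: partial_bij_def pinj_ppow pinj_comp\<close>)

lemma gen_semigroup_pinv:
  assumes a: "partial_bij I a" and s: "s \<in> gen_semigroup I a"
  shows "pinv s \<in> gen_semigroup I a"
  using s
proof induction
  case (power n)
  show ?case by (simp add: pinv_ppow[OF a] gen_semigroup.power)
next
  case (comp s t)
  thus ?case
    by (simp add: pinv_comp gen_semigroup_pinj[OF a] gen_semigroup.comp)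
qed

text \<open>
  Restrictions of powers are closed under composition by \<open>ppow_comp_le\<close>; this is why the integers suffice to index the monomials of the cylinder.
\<close>

lemma gen_semigroup_le_ppow:
  assumes a: "partial_bij I a" and s: "s \<in> gen_semigroup I a"
  shows "\<exists>n. s \<subseteq>\<^sub>m ppow I a n"
  using s
proof induction
  case (power n)
  show ?case by (meson map_le_refl)
next
  case (comp s t)
  thus ?case
    by (meson comp_mono map_le_trans ppow_comp_le[OF a])
qed

text \<open>
  The natural partial order of the inverse semigroup is restriction of maps: a restriction
  \<open>s\<close> of \<open>t\<close> is recovered as \<open>s s\<^sup>* t\<close>, and the idempotent \<open>s s\<^sup>*\<close> belongs to the semigroup.
\<close>

lemma semigroup_le_iff_map_le:
  assumes a: "partial_bij I a" and s: "s \<in> gen_semigroup I a" and t: "t \<in> gen_semigroup I a"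
  shows "semigroup_le (gen_semigroup I a) s t \<longleftrightarrow> s \<subseteq>\<^sub>m t"
proof
  assume "semigroup_le (gen_semigroup I a) s t"
  then obtain q where q: "q \<in> gen_semigroup I a" "q \<circ>\<^sub>m q = q" "s = q \<circ>\<^sub>m t"
    by (auto simp: semigroup_le_def)
  have "q \<subseteq>\<^sub>m Some"
    using idempotent_pinj_le_id gen_semigroup_pinj[OF a q(1)] q(2) by blast
  thus "s \<subseteq>\<^sub>m t"
    unfolding q(3) by (intro map_leI) (auto simp: map_comp_Some_iff dest: map_leD)
next
  assume st: "s \<subseteq>\<^sub>m t"
  have pi: "pinj s" "pinj t"
    using s t gen_semigroup_pinj[OF a] by auto
  \<comment> \<open>The identity of the range of \<open>s\<close> is an idempotent that cuts \<open>t\<close> down to \<open>s\<close>.\<close>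
  have "s \<circ>\<^sub>m pinv s \<in> gen_semigroup I a"
    using s by (intro gen_semigroup.comp gen_semigroup_pinv[OF a])
  moreover have "(s \<circ>\<^sub>m pinv s) \<circ>\<^sub>m (s \<circ>\<^sub>m pinv s) = s \<circ>\<^sub>m pinv s"
    using pi by (intro map_eqI) (auto simp: map_comp_Some_iff pinv_eq_Some_iff)
  moreover have "s = (s \<circ>\<^sub>m pinv s) \<circ>\<^sub>m t"
    using pi map_leD[OF st]
    by (intro map_eqI) (auto simp: map_comp_Some_iff pinv_eq_Some_iff dest: pinj_D)
  ultimately show "semigroup_le (gen_semigroup I a) s t"
    unfolding semigroup_le_def by blast
qed

section \<open>Transport of functions along partial injections\<close>

lemma hat_eq: "pinj s \<Longrightarrow> s x = Some y \<Longrightarrow> hat s f y = f x"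
  by (simp add: hat_def pinv_eq_Some_iff[THEN iffD2])

lemma hat_outside: "y \<notin> ran s \<Longrightarrow> hat s f y = 0"
  by (simp add: hat_def pinv_def)

lemma hat_zero: "hat s 0 = 0"
  by (auto simp: hat_def fun_eq_iff split: option.splits)

lemma hat_add: "hat s (f + g) = hat s f + hat s g"
  by (auto simp: hat_def fun_eq_iff split: option.splits)

lemma hat_mult: "hat s (f * g) = hat s f * hat s g"
  by (auto simp: hat_def fun_eq_iff split: option.splits)

lemma hat_scale: "hat s (\<lambda>x. c * f x) = (\<lambda>x. c * hat s f x)"
  by (auto simp: hat_def fun_eq_iff split: option.splits)

lemma hat_cnj: "hat s (\<lambda>x. cnj (f x)) = (\<lambda>x. cnj (hat s f x))"
  by (auto simp: hat_def fun_eq_iff split: option.splits)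

lemma hat_comp:
  assumes "pinj s" "pinj t"
  shows "hat (s \<circ>\<^sub>m t) f = hat s (hat t f)"
  unfolding hat_def pinv_comp[OF assms] by (auto simp: fun_eq_iff map_comp_def split: option.splits)

lemma hat_hat_pinv:
  assumes s: "pinj s"
  shows "hat s (hat (pinv s) f) y = (if y \<in> ran s then f y else 0)"
proof (cases "y \<in> ran s")
  case True
  then obtain x where xy: "s x = Some y" by (auto simp: ran_def)
  have "hat s (hat (pinv s) f) y = hat (pinv s) f x"
    by (rule hat_eq[OF s xy])
  also have "\<dots> = f y"
    by (rule hat_eq) (simp_all add: pinj_pinv[OF s] pinv_eq_Some_iff[OF s] xy)
  finally show ?thesis
    using True by simp
qed (simp add: hat_outside)

lemma hat_restriction:
  assumes "pinj t" "s \<subseteq>\<^sub>m t" "y \<in> ran s"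
  shows "hat s f y = hat t f y"
proof -
  obtain x where x: "s x = Some y" using assms(3) by (auto simp: ran_def)
  show ?thesis
    using hat_eq[OF pinj_mono[OF assms(1,2)] x] hat_eq[OF assms(1) map_leD[OF assms(2) x]] by simp
qed


section \<open>Additive extension from monomials\<close>

text \<open>
  Multiplication, involution and the representation are all given on monomials \<open>f \<delta>\<^sub>s\<close> by
  a formula additive in \<open>f\<close>. Summing over the support then gives an additive map, so identities
  between such maps need to be checked on monomials only.
\<close>

definition linear_ext :: "('a \<Rightarrow> 'b \<Rightarrow> 'c) \<Rightarrow> ('a \<Rightarrow>\<^sub>0 'b::ab_group_add) \<Rightarrow> 'c::ab_group_add" where
  "linear_ext g A = (\<Sum>s\<in>Poly_Mapping.keys A. g s (Poly_Mapping.lookup A s))"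

definition additive_family :: "('a \<Rightarrow> 'b::ab_group_add \<Rightarrow> 'c::ab_group_add) \<Rightarrow> bool" where
  "additive_family g \<longleftrightarrow> (\<forall>s x y. g s (x + y) = g s x + g s y)"

lemma additive_family_zero: "additive_family g \<Longrightarrow> g s 0 = 0"
  unfolding additive_family_def by (metis add_0 add_cancel_right_right)

lemma linear_ext_zero: "linear_ext g 0 = 0"
  by (simp add: linear_ext_def)

lemma linear_ext_single: "additive_family g \<Longrightarrow> linear_ext g (Poly_Mapping.single s f) = g s f"
  by (cases "f = 0") (simp_all add: linear_ext_def additive_family_zero)

lemma linear_ext_superset:
  assumes "additive_family g" "finite K" "Poly_Mapping.keys A \<subseteq> K"
  shows "linear_ext g A = (\<Sum>s\<in>K. g s (Poly_Mapping.lookup A s))"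
  unfolding linear_ext_def using assms
  by (intro sum.mono_neutral_left)
    (auto simp: in_keys_iff additive_family_zero)

lemma linear_ext_add:
  assumes g: "additive_family g"
  shows "linear_ext g (A + B) = linear_ext g A + linear_ext g B"
proof -
  let ?K = "Poly_Mapping.keys A \<union> Poly_Mapping.keys B"
  have "linear_ext g (A + B) = (\<Sum>s\<in>?K. g s (Poly_Mapping.lookup (A + B) s))"
    by (rule linear_ext_superset[OF g]) (auto simp: keys_add)
  also have "\<dots> = (\<Sum>s\<in>?K. g s (Poly_Mapping.lookup A s)) + (\<Sum>s\<in>?K. g s (Poly_Mapping.lookup B s))"
    using g by (simp add: lookup_add additive_family_def sum.distrib)
  also have "\<dots> = linear_ext g A + linear_ext g B"
    using g by (simp add: linear_ext_superset[of g ?K])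
  finally show ?thesis .
qed

lemma linear_ext_sum:
  assumes g: "additive_family g"
  shows "linear_ext g (sum A K) = (\<Sum>k\<in>K. linear_ext g (A k))"
  by (induction K rule: infinite_finite_induct)
    (simp_all add: linear_ext_zero linear_ext_add[OF g])

lemma linear_ext_uminus:
  assumes g: "additive_family g"
  shows "linear_ext g (- A) = - linear_ext g A"
  using linear_ext_add[OF g, of A "- A"] by (simp add: linear_ext_zero eq_neg_iff_add_eq_0 add.commute)

lemma linear_ext_diff:
  assumes g: "additive_family g"
  shows "linear_ext g (A - B) = linear_ext g A - linear_ext g B"
  using linear_ext_add[OF g, of A "- B"] by (simp add: linear_ext_uminus[OF g])

lemma L_mult_single_left:
  "L_mult (Poly_Mapping.single s f) B =
     linear_ext (\<lambda>t g. Poly_Mapping.single (s \<circ>\<^sub>m t) (hat s (hat (pinv s) f * g))) B"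
proof (cases "f = 0")
  case True
  have "hat s (hat (pinv s) 0 * g) = 0" for g
    by (simp add: hat_zero)
  with True show ?thesis
    by (simp add: L_mult_def linear_ext_def)
qed (simp add: L_mult_def linear_ext_def)

lemma additive_mult_right:
  "additive_family (\<lambda>t g. Poly_Mapping.single (s \<circ>\<^sub>m t) (hat s (hat (pinv s) f * g)))"
  by (simp add: additive_family_def distrib_left hat_add single_add)

lemma L_mult_single_single:
  "L_mult (Poly_Mapping.single s f) (Poly_Mapping.single t g) =
     Poly_Mapping.single (s \<circ>\<^sub>m t) (hat s (hat (pinv s) f * g))"
  by (simp add: L_mult_single_left linear_ext_single[OF additive_mult_right])

lemma L_mult_eq:
  "L_mult A B = linear_ext (\<lambda>s f. L_mult (Poly_Mapping.single s f) B) A"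
  unfolding L_mult_single_left by (simp add: L_mult_def linear_ext_def)

lemma additive_mult_left: "additive_family (\<lambda>s f. L_mult (Poly_Mapping.single s f) B)"
  unfolding additive_family_def L_mult_single_left linear_ext_def
  by (simp add: hat_add distrib_right single_add sum.distrib)

lemma L_mult_add_left: "L_mult (A + A') B = L_mult A B + L_mult A' B"
  using linear_ext_add[OF additive_mult_left, of B A A'] by (simp only: L_mult_eq[symmetric])

lemma L_mult_add_right: "L_mult A (B + B') = L_mult A B + L_mult A B'"
proof -
  have monomial: "L_mult (Poly_Mapping.single s f) (B + B') =
      L_mult (Poly_Mapping.single s f) B + L_mult (Poly_Mapping.single s f) B'" for s f
    unfolding L_mult_single_left by (rule linear_ext_add[OF additive_mult_right])
  show ?thesis
    unfolding L_mult_eq[of A "B + B'"] L_mult_eq[of A B] L_mult_eq[of A B'] monomial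
    by (simp only: linear_ext_def sum.distrib)
qed

lemma L_mult_zero: "L_mult 0 B = 0" "L_mult A 0 = 0"
  by (simp_all add: L_mult_def)

lemma L_star_eq:
  "L_star = linear_ext (\<lambda>s f. Poly_Mapping.single (pinv s) (hat (pinv s) (\<lambda>x. cnj (f x))))"
  by (simp add: L_star_def linear_ext_def fun_eq_iff)

lemma additive_star:
  "additive_family (\<lambda>s f. Poly_Mapping.single (pinv s) (hat (pinv s) (\<lambda>x. cnj (f x))))"
  unfolding additive_family_def hat_cnj hat_add single_add[symmetric] by (simp add: plus_fun_def)

lemma L_star_single:
  "L_star (Poly_Mapping.single s f) = Poly_Mapping.single (pinv s) (hat (pinv s) (\<lambda>x. cnj (f x)))"
  by (simp add: L_star_eq linear_ext_single[OF additive_star])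

lemma L_star_add: "L_star (A + B) = L_star A + L_star B"
  by (simp add: L_star_eq linear_ext_add[OF additive_star])

lemma L_star_diff: "L_star (A - B) = L_star A - L_star B"
  by (simp add: L_star_eq linear_ext_diff[OF additive_star])

lemma L_star_zero: "L_star 0 = 0"
  by (simp add: L_star_eq linear_ext_zero)

lemma lookup_L_scale: "Poly_Mapping.lookup (L_scale c A) s = (\<lambda>x. c * Poly_Mapping.lookup A s x)"
  by (simp add: L_scale_def Poly_Mapping.map.rep_eq when_def fun_eq_iff)

lemma L_scale_add: "L_scale c (A + B) = L_scale c A + L_scale c B"
  by (rule poly_mapping_eqI) (simp add: lookup_L_scale lookup_add distrib_left plus_fun_def)

lemma L_scale_single: "L_scale c (Poly_Mapping.single s f) = Poly_Mapping.single s (\<lambda>x. c * f x)"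
  by (rule poly_mapping_eqI) (simp add: lookup_L_scale lookup_single when_def fun_eq_iff)

lemma L_scale_zero: "L_scale c 0 = 0"
  by (rule poly_mapping_eqI) (simp add: lookup_L_scale fun_eq_iff)

lemma L_scale_minus_one: "L_scale (- 1) A = - A"
  by (rule poly_mapping_eqI) (simp add: lookup_L_scale fun_eq_iff)

lemma keys_L_scale: "Poly_Mapping.keys (L_scale c A) \<subseteq> Poly_Mapping.keys A"
  by (auto simp: in_keys_iff lookup_L_scale fun_eq_iff)

lemma sum_singles: "(\<Sum>s\<in>Poly_Mapping.keys A. Poly_Mapping.single s (Poly_Mapping.lookup A s)) = A"
  by (rule poly_mapping_eqI)
    (auto simp: lookup_sum lookup_single when_def sum.delta' in_keys_iff)

section \<open>The algebra of the cylinder\<close>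

definition function_star_algebra :: "(real \<Rightarrow> complex) set \<Rightarrow> bool" where
  "function_star_algebra F \<longleftrightarrow> 0 \<in> F \<and>
     (\<forall>f\<in>F. \<forall>g\<in>F. f + g \<in> F \<and> f * g \<in> F) \<and>
     (\<forall>f\<in>F. (\<forall>c. (\<lambda>x. c * f x) \<in> F) \<and> (\<lambda>x. cnj (f x)) \<in> F)"

locale fuzzy_cylinder =
  fixes I :: "real set" and a :: "real \<rightharpoonup> real" and F :: "(real \<Rightarrow> complex) set"
  assumes pb: "partial_bij I a"
    and alg: "function_star_algebra F"
    and hat_ideal: "s \<in> gen_semigroup I a \<Longrightarrow> f \<in> ideal_on F (dom s) \<Longrightarrow> hat s f \<in> ideal_on F (ran s)"
begin

abbreviation "S \<equiv> gen_semigroup I a"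
abbreviation "L \<equiv> L_carrier I a F"
abbreviation "N \<equiv> N_ideal I a F"
abbreviation "cls \<equiv> L_class I a F"

lemma F_zero: "0 \<in> F"
  and F_add: "f \<in> F \<Longrightarrow> g \<in> F \<Longrightarrow> f + g \<in> F"
  and F_mult: "f \<in> F \<Longrightarrow> g \<in> F \<Longrightarrow> f * g \<in> F"
  and F_scale: "f \<in> F \<Longrightarrow> (\<lambda>x. c * f x) \<in> F"
  and F_cnj: "f \<in> F \<Longrightarrow> (\<lambda>x. cnj (f x)) \<in> F"
  using alg unfolding function_star_algebra_def by blast+

lemma S_pinj: "s \<in> S \<Longrightarrow> pinj s"
  by (rule gen_semigroup_pinj[OF pb])

lemma S_pinv: "s \<in> S \<Longrightarrow> pinv s \<in> S"
  by (rule gen_semigroup_pinv[OF pb])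

lemma ideal_on_mono: "Y \<subseteq> Z \<Longrightarrow> f \<in> ideal_on F Y \<Longrightarrow> f \<in> ideal_on F Z"
  by (auto simp: ideal_on_def)

lemma ideal_on_zero: "0 \<in> ideal_on F Y"
  by (simp add: ideal_on_def F_zero)

lemma ideal_on_add: "f \<in> ideal_on F Y \<Longrightarrow> g \<in> ideal_on F Y \<Longrightarrow> f + g \<in> ideal_on F Y"
  by (simp add: ideal_on_def F_add)

lemma hat_pinv_ideal: "s \<in> S \<Longrightarrow> f \<in> ideal_on F (ran s) \<Longrightarrow> hat (pinv s) f \<in> ideal_on F (dom s)"
  using hat_ideal[OF S_pinv, of s f] by (simp add: dom_pinv ran_pinv S_pinj)

text \<open>
  The product is taken inside the ideal of the domain of \<open>s\<close>, which transport along \<open>s\<close>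
  carries into \<open>F\<close> by \<open>hat_ideal\<close>. The result vanishes off the range of \<open>s t\<close> because
  \<open>g\<close> vanishes off the range of \<open>t\<close>.
\<close>

lemma mult_ideal:
  assumes s: "s \<in> S" and t: "t \<in> S" and f: "f \<in> ideal_on F (ran s)" and g: "g \<in> ideal_on F (ran t)"
  shows "hat s (hat (pinv s) f * g) \<in> ideal_on F (ran (s \<circ>\<^sub>m t))"
proof -
  have "hat (pinv s) f * g \<in> ideal_on F (dom s)"
    using hat_pinv_ideal[OF s f] g by (auto simp: ideal_on_def F_mult)
  hence "hat s (hat (pinv s) f * g) \<in> F"
    using hat_ideal[OF s] by (auto simp: ideal_on_def)
  moreover have "hat s (hat (pinv s) f * g) y = 0" if y: "y \<notin> ran (s \<circ>\<^sub>m t)" for y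
  proof (cases "y \<in> ran s")
    case True
    then obtain x where x: "s x = Some y" by (auto simp: ran_def)
    hence "x \<notin> ran t"
      using y by (force simp: ran_def map_comp_Some_iff)
    hence "g x = 0" using g by (auto simp: ideal_on_def)
    thus ?thesis by (simp add: hat_eq[OF S_pinj[OF s] x])
  qed (simp add: hat_outside)
  ultimately show ?thesis by (simp add: ideal_on_def)
qed

lemma star_ideal:
  assumes "s \<in> S" "f \<in> ideal_on F (ran s)"
  shows "hat (pinv s) (\<lambda>x. cnj (f x)) \<in> ideal_on F (ran (pinv s))"
proof -
  have "(\<lambda>x. cnj (f x)) \<in> ideal_on F (ran s)"
    using assms(2) F_cnj[of f] by (simp add: ideal_on_def)
  thus ?thesis
    unfolding ran_pinv[OF S_pinj[OF assms(1)]] by (rule hat_pinv_ideal[OF assms(1)])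
qed

lemma L_zero: "0 \<in> L"
  by (simp add: L_carrier_def)

lemma L_single: "s \<in> S \<Longrightarrow> f \<in> ideal_on F (ran s) \<Longrightarrow> Poly_Mapping.single s f \<in> L"
  by (auto simp: L_carrier_def)

lemma L_iff:
  "A \<in> L \<longleftrightarrow> Poly_Mapping.keys A \<subseteq> S \<and> (\<forall>s. Poly_Mapping.lookup A s \<in> ideal_on F (ran s))"
proof -
  have "Poly_Mapping.lookup A s \<in> ideal_on F (ran s)" if "s \<notin> Poly_Mapping.keys A" for s
    using that ideal_on_zero by (simp add: in_keys_iff)
  thus ?thesis unfolding L_carrier_def by blast
qed

lemma L_add: "A \<in> L \<Longrightarrow> B \<in> L \<Longrightarrow> A + B \<in> L"
  using keys_add[of A B] by (auto simp: L_iff lookup_add ideal_on_add)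

lemma L_scale: "A \<in> L \<Longrightarrow> L_scale c A \<in> L"
  using keys_L_scale[of c A] by (auto simp: L_iff lookup_L_scale ideal_on_def F_scale)

lemma L_sum: "(\<And>k. k \<in> K \<Longrightarrow> A k \<in> L) \<Longrightarrow> sum A K \<in> L"
  by (induction K rule: infinite_finite_induct) (auto simp: L_zero L_add)

lemma L_induct [consumes 1, case_names zero single add]:
  assumes A: "A \<in> L"
    and "P 0"
    and "\<And>s f. s \<in> S \<Longrightarrow> f \<in> ideal_on F (ran s) \<Longrightarrow> P (Poly_Mapping.single s f)"
    and "\<And>A B. A \<in> L \<Longrightarrow> B \<in> L \<Longrightarrow> P A \<Longrightarrow> P B \<Longrightarrow> P (A + B)"
  shows "P A"
proof -
  have "P (sum B K)" if "\<And>k. k \<in> K \<Longrightarrow> B k \<in> L" "\<And>k. k \<in> K \<Longrightarrow> P (B k)"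
    for B and K :: "(real \<rightharpoonup> real) set"
    using that
  proof (induction K rule: infinite_finite_induct)
    case (insert k K)
    have "sum B K \<in> L"
      using insert.prems(1) by (intro L_sum) simp
    moreover have "P (sum B K)"
      using insert.prems by (intro insert.IH) simp_all
    ultimately have "P (B k + sum B K)"
      using insert.prems by (intro assms(4)) simp_all
    thus ?case using insert.hyps by simp
  qed (simp_all add: assms(2))
  moreover have "s \<in> S" "Poly_Mapping.lookup A s \<in> ideal_on F (ran s)"
    if "s \<in> Poly_Mapping.keys A" for s
    using A that by (auto simp: L_iff)
  ultimately have "P (\<Sum>s\<in>Poly_Mapping.keys A. Poly_Mapping.single s (Poly_Mapping.lookup A s))"
    by (simp add: L_single assms(3))
  thus ?thesis by (simp only: sum_singles)
qed

lemma L_mult: "A \<in> L \<Longrightarrow> B \<in> L \<Longrightarrow> L_mult A B \<in> L"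
  unfolding L_mult_def
  by (intro L_sum L_single mult_ideal gen_semigroup.comp) (auto simp: L_iff)

lemma L_star: "A \<in> L \<Longrightarrow> L_star A \<in> L"
  unfolding L_star_def
  by (intro L_sum L_single star_ideal S_pinv) (auto simp: L_iff)

lemma N_gens_L: "N_gens I a F \<subseteq> L"
proof
  fix A assume "A \<in> N_gens I a F"
  then obtain s t f where *: "A = Poly_Mapping.single s f - Poly_Mapping.single t f" "s \<in> S" "t \<in> S"
      "s \<subseteq>\<^sub>m t" "f \<in> ideal_on F (ran s)"
    unfolding N_gens_def using semigroup_le_iff_map_le[OF pb] by blast
  have "ran s \<subseteq> ran t"
    using map_leD[OF *(4)] by (auto simp: ran_def)
  hence "Poly_Mapping.single t f \<in> L"
    using * ideal_on_mono by (blast intro: L_single)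
  moreover have "Poly_Mapping.single s f \<in> L"
    using * by (blast intro: L_single)
  ultimately show "A \<in> L"
    using L_add[OF _ L_scale[of _ "- 1"]] *(1) by (simp add: L_scale_minus_one)
qed

lemma L_ideal_L: "L_ideal I a F L"
  by (simp add: L_ideal_def L_zero L_add L_scale L_mult)

lemma N_subset: "L_ideal I a F J \<Longrightarrow> N_gens I a F \<subseteq> J \<Longrightarrow> N \<subseteq> J"
  by (auto simp: N_ideal_def)

lemma N_L: "N \<subseteq> L"
  by (rule N_subset[OF L_ideal_L N_gens_L])

lemma N_gens_N: "N_gens I a F \<subseteq> N"
  by (auto simp: N_ideal_def)

lemma L_ideal_N: "L_ideal I a F N"
proof -
  have "0 \<in> N" "A \<in> N \<Longrightarrow> B \<in> N \<Longrightarrow> A + B \<in> N" "A \<in> N \<Longrightarrow> L_scale c A \<in> N"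
    "A \<in> N \<Longrightarrow> B \<in> L \<Longrightarrow> L_mult A B \<in> N" "A \<in> N \<Longrightarrow> B \<in> L \<Longrightarrow> L_mult B A \<in> N" for A B c
    by (auto simp: N_ideal_def L_ideal_def)
  with N_L show ?thesis by (auto simp: L_ideal_def)
qed

lemma N_zero: "0 \<in> N" and N_add: "A \<in> N \<Longrightarrow> B \<in> N \<Longrightarrow> A + B \<in> N"
  and N_scale: "A \<in> N \<Longrightarrow> L_scale c A \<in> N"
  and N_mult: "A \<in> N \<Longrightarrow> B \<in> L \<Longrightarrow> L_mult A B \<in> N" "A \<in> N \<Longrightarrow> B \<in> L \<Longrightarrow> L_mult B A \<in> N"
  using L_ideal_N by (auto simp: L_ideal_def)

lemma N_uminus: "A \<in> N \<Longrightarrow> - A \<in> N"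
  using N_scale[of A "- 1"] by (simp add: L_scale_minus_one)

lemma N_diff: "A \<in> N \<Longrightarrow> B \<in> N \<Longrightarrow> A - B \<in> N"
  using N_add[OF _ N_uminus, of A B] by simp

lemma restriction_relation_N:
  assumes "s \<in> S" "t \<in> S" "s \<subseteq>\<^sub>m t" "f \<in> ideal_on F (ran s)"
  shows "Poly_Mapping.single s f - Poly_Mapping.single t f \<in> N"
  using assms N_gens_N semigroup_le_iff_map_le[OF pb] unfolding N_gens_def by blast

text \<open>
  On monomials both sides are carried by the inverse of \<open>s t\<close>. The coefficients agree because
  transporting along a map and back is cutting off to its domain, and the functions involved
  already vanish outside the sets in question.
\<close>

lemma L_star_mult:
  assumes "A \<in> L" "B \<in> L"
  shows "L_star (L_mult A B) = L_mult (L_star B) (L_star A)"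
  using assms
proof (induction A rule: L_induct)
  case zero
  show ?case by (simp add: L_mult_zero L_star_zero)
next
  case (add A A')
  thus ?case by (simp add: L_mult_add_left L_mult_add_right L_star_add)
next
  case (single s f)
  note s = single(1,2)
  from single(3) show ?case
  proof (induction B rule: L_induct)
    case zero
    show ?case by (simp add: L_mult_zero L_star_zero)
  next
    case (add A A')
    thus ?case by (simp add: L_mult_add_left L_mult_add_right L_star_add)
  next
    case (single t g)
    let ?f = "\<lambda>x. cnj (f x)" and ?g = "\<lambda>x. cnj (g x)"
    have pi: "pinj s" "pinj t" using s single S_pinj by auto
    have dom: "hat (pinv s) ?f x = 0" if "x \<notin> dom s" for x
      using that pi by (simp add: hat_outside ran_pinv)
    have "(\<lambda>x. cnj (hat s (hat (pinv s) f * g) x)) = hat s (hat (pinv s) ?f * ?g)"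
      by (simp add: hat_mult hat_cnj fun_eq_iff)
    hence "hat (pinv (s \<circ>\<^sub>m t)) (\<lambda>x. cnj (hat s (hat (pinv s) f * g) x)) =
        hat (pinv t) (hat (pinv s) (hat s (hat (pinv s) ?f * ?g)))"
      using pi by (simp add: pinv_comp hat_comp pinj_pinv)
    also have "hat (pinv s) (hat s (hat (pinv s) ?f * ?g)) = hat (pinv s) ?f * ?g"
      using hat_hat_pinv[OF pinj_pinv[OF pi(1)]] dom
      by (auto simp: fun_eq_iff pinv_pinv pi ran_pinv)
    also have "\<dots> = hat t (hat (pinv t) ?g) * hat (pinv s) ?f"
      using single(2) by (auto simp: fun_eq_iff hat_hat_pinv pi ideal_on_def)
    finally show ?case
      unfolding L_mult_single_single L_star_single pinv_comp[OF pi] pinv_pinv[OF pi(2)] by (simp only:)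
  qed
qed

text \<open>
  The relations are stable under the involution because restriction of maps is preserved by
  taking inverses. The elements whose adjoint lies in \<open>N\<close> form an ideal, because the involution
  reverses products, so it is enough to check the generators.
\<close>

lemma N_star: "A \<in> N \<Longrightarrow> L_star A \<in> N"
proof -
  let ?J = "{A \<in> L. L_star A \<in> N}"
  have "L_star (L_scale c A) = L_scale (cnj c) (L_star A)" if "A \<in> L" for c A
    using that
  proof (induction A rule: L_induct)
    case (single s f)
    show ?case
      by (simp add: L_scale_single L_star_single hat_cnj hat_scale)
  qed (simp_all add: L_scale_add L_star_add L_star_zero L_scale_zero)
  hence "L_ideal I a F ?J"
    unfolding L_ideal_def
    by (auto simp: L_zero L_add L_scale L_mult L_star_zero L_star_add L_star_mult
        N_zero N_add N_scale N_mult L_star)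
  moreover have "N_gens I a F \<subseteq> ?J"
  proof
    fix A assume A: "A \<in> N_gens I a F"
    then obtain s t f where *: "A = Poly_Mapping.single s f - Poly_Mapping.single t f" "s \<in> S" "t \<in> S"
        "s \<subseteq>\<^sub>m t" "f \<in> ideal_on F (ran s)"
      unfolding N_gens_def using semigroup_le_iff_map_le[OF pb] by blast
    have pi: "pinj s" "pinj t" using * S_pinj by auto
    have "hat (pinv t) (\<lambda>x. cnj (f x)) x = hat (pinv s) (\<lambda>x. cnj (f x)) x" for x
    proof (cases "x \<in> dom s")
      case True
      thus ?thesis
        using hat_restriction[OF pinj_pinv[OF pi(2)] pinv_mono[OF pi(2) *(4)]] pi by (simp add: ran_pinv)
    next
      case False
      have "hat (pinv t) (\<lambda>x. cnj (f x)) x = 0"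
      proof (cases "t x")
        case (Some y)
        hence "y \<notin> ran s"
          using False pi(2) map_leD[OF *(4)] by (auto simp: ran_def dest: pinj_D)
        thus ?thesis
          using Some *(5) pi hat_eq[of "pinv t" y x]
          by (simp add: pinj_pinv pinv_eq_Some_iff ideal_on_def)
      next
        case None
        hence "x \<notin> ran (pinv t)" by (auto simp: ran_pinv[OF pi(2)])
        thus ?thesis by (rule hat_outside)
      qed
      with False show ?thesis by (simp add: hat_outside ran_pinv pi)
    qed
    hence hats: "hat (pinv t) (\<lambda>x. cnj (f x)) = hat (pinv s) (\<lambda>x. cnj (f x))"
      by (rule ext)
    have "L_star A = Poly_Mapping.single (pinv s) (hat (pinv s) (\<lambda>x. cnj (f x)))
        - Poly_Mapping.single (pinv t) (hat (pinv s) (\<lambda>x. cnj (f x)))"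
      unfolding *(1) L_star_diff L_star_single hats ..
    moreover have "\<dots> \<in> N"
      by (intro restriction_relation_N S_pinv star_ideal pinv_mono * pi)
    ultimately show "A \<in> ?J"
      using A N_gens_L by auto
  qed
  ultimately show "A \<in> N \<Longrightarrow> L_star A \<in> N"
    using N_subset by blast
qed

lemma cls_eq_iff: "cls A = cls B \<longleftrightarrow> A - B \<in> N"
proof
  assume "cls A = cls B"
  hence "A + 0 \<in> (+) B ` N"
    unfolding L_class_def using N_zero by blast
  thus "A - B \<in> N" by auto
next
  assume N: "A - B \<in> N"
  have "A + C = B + (A - B + C)" "B + C = A + (C - (A - B))" for C by simp_all
  hence "C \<in> N \<Longrightarrow> A + C \<in> cls B" "C \<in> N \<Longrightarrow> B + C \<in> cls A" for C
    unfolding L_class_def using N N_add N_diff by blast+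
  thus "cls A = cls B"
    unfolding L_class_def by blast
qed

lemma mem_cls_iff: "B \<in> cls A \<longleftrightarrow> B - A \<in> N"
  unfolding L_class_def by force

lemma mem_cls_self: "A \<in> cls A"
  by (simp add: mem_cls_iff N_zero)

lemma cls_subset_L: "A \<in> L \<Longrightarrow> cls A \<subseteq> L"
  unfolding L_class_def using N_L L_add by blast

text \<open>
  Each operation of the quotient is a union over representatives that all give the same class,
  since the relations form an ideal stable under the involution.
\<close>

lemma Cyl_add_cls: "Cyl_add I a F (cls A) (cls B) = cls (A + B)"
proof -
  have "cls (A' + B') = cls (A + B)" if "A' \<in> cls A" "B' \<in> cls B" for A' B'
    using N_add that unfolding mem_cls_iff cls_eq_iff by (metis add_diff_add)
  thus ?thesis
    unfolding Cyl_add_def using mem_cls_self by blast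
qed

lemma Cyl_scale_cls: "Cyl_scale I a F z (cls A) = cls (L_scale z A)"
proof -
  have "cls (L_scale z A') = cls (L_scale z A)" if "A' \<in> cls A" for A'
  proof -
    have "L_scale z A' = L_scale z (A' - A) + L_scale z A"
      by (simp flip: L_scale_add)
    thus ?thesis using N_scale[of "A' - A" z] that by (simp add: mem_cls_iff cls_eq_iff)
  qed
  thus ?thesis
    unfolding Cyl_scale_def using mem_cls_self by blast
qed

lemma Cyl_mult_cls:
  assumes A: "A \<in> L" and B: "B \<in> L"
  shows "Cyl_mult I a F (cls A) (cls B) = cls (L_mult A B)"
proof -
  have "cls (L_mult A' B') = cls (L_mult A B)" if "A' \<in> cls A" "B' \<in> cls B" for A' B'
  proof -
    have A': "A' - A \<in> N" and B': "B' - B \<in> N" and "B' \<in> L"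
      using that cls_subset_L[OF B] unfolding mem_cls_iff[symmetric] by blast+
    have "L_mult A' B' = L_mult (A' - A) B' + L_mult A (B' - B) + L_mult A B"
      by (simp add: add.assoc flip: L_mult_add_left L_mult_add_right)
    moreover have "L_mult (A' - A) B' + L_mult A (B' - B) \<in> N"
      by (intro N_add N_mult A A' B' \<open>B' \<in> L\<close>)
    ultimately show ?thesis by (simp add: cls_eq_iff)
  qed
  thus ?thesis
    unfolding Cyl_mult_def using mem_cls_self by blast
qed

lemma Cyl_star_cls: "Cyl_star I a F (cls A) = cls (L_star A)"
proof -
  have "cls (L_star A') = cls (L_star A)" if "A' \<in> cls A" for A'
    using that N_star by (simp add: mem_cls_iff cls_eq_iff flip: L_star_diff)
  thus ?thesis
    unfolding Cyl_star_def using mem_cls_self by blast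
qed

lemma sum_ppow_L:
  assumes "f \<in> coeff_families I a F"
  shows "(\<Sum>n\<in>Poly_Mapping.keys f. Poly_Mapping.single (ppow I a n) (Poly_Mapping.lookup f n)) \<in> L"
  using assms by (intro L_sum L_single gen_semigroup.power) (simp add: coeff_families_def)

text \<open>
  Each element of the semigroup restricts a power, so every monomial is equivalent to one
  of the form \<open>f \<delta>\<^sub>n\<close>.
\<close>

lemma Cyl_eq_sums: "Cyl I a F = Cyl_sum I a F ` coeff_families I a F"
proof
  show "Cyl_sum I a F ` coeff_families I a F \<subseteq> Cyl I a F"
    using sum_ppow_L by (auto simp: Cyl_def Cyl_sum_def)
next
  let ?p = "linear_ext (\<lambda>n. Poly_Mapping.single (ppow I a n)) ::
    (int \<Rightarrow>\<^sub>0 (real \<Rightarrow> complex)) \<Rightarrow> lelem"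
  have add: "additive_family (\<lambda>n. Poly_Mapping.single (ppow I a n) :: (real \<Rightarrow> complex) \<Rightarrow> lelem)"
    by (simp add: additive_family_def single_add)
  have "\<exists>f\<in>coeff_families I a F. cls A = cls (?p f)" if "A \<in> L" for A
    using that
  proof (induction A rule: L_induct)
    case zero
    have "0 \<in> coeff_families I a F" by (simp add: coeff_families_def ideal_on_zero)
    moreover have "?p 0 = 0" by (rule linear_ext_zero)
    ultimately show ?case by metis
  next
    case (single s f)
    then obtain n where n: "s \<subseteq>\<^sub>m ppow I a n"
      using gen_semigroup_le_ppow[OF pb] by blast
    hence "ran s \<subseteq> ran (ppow I a n)"
      by (auto simp: ran_def dest: map_leD)
    hence "Poly_Mapping.single n f \<in> coeff_families I a F"
      using single ideal_on_mono ideal_on_zero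
      by (auto simp: coeff_families_def lookup_single when_def)
    moreover have "cls (Poly_Mapping.single s f) = cls (?p (Poly_Mapping.single n f))"
      using single n restriction_relation_N gen_semigroup.power
      by (simp add: cls_eq_iff linear_ext_single[OF add])
    ultimately show ?case by blast
  next
    case (add A B)
    then obtain f g where fg: "f \<in> coeff_families I a F" "g \<in> coeff_families I a F"
        "cls A = cls (?p f)" "cls B = cls (?p g)" by blast
    have "f + g \<in> coeff_families I a F"
      using fg by (simp add: coeff_families_def lookup_add ideal_on_add)
    moreover have "cls (A + B) = cls (?p (f + g))"
      using fg linear_ext_add[OF \<open>additive_family _\<close>, of f g] by (metis Cyl_add_cls)
    ultimately show ?case by blast
  qed
  thus "Cyl I a F \<subseteq> Cyl_sum I a F ` coeff_families I a F"
    unfolding Cyl_def Cyl_sum_def linear_ext_def by auto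
qed

end


section \<open>The covariant action on functions\<close>

text \<open>
  This is the representation before any Hilbert space is chosen: the monomial \<open>f \<delta>\<^sub>s\<close>
  transports along \<open>s\<close> and then multiplies by \<open>f\<close>.
\<close>

definition rep :: "lelem \<Rightarrow> (real \<Rightarrow> complex) \<Rightarrow> (real \<Rightarrow> complex)" where
  "rep A \<psi> = linear_ext (\<lambda>s f. f * hat s \<psi>) A"

lemma additive_rep: "additive_family (\<lambda>s f. f * hat s \<psi>)"
  by (simp add: additive_family_def distrib_right)

lemma rep_single: "rep (Poly_Mapping.single s f) \<psi> = f * hat s \<psi>"
  unfolding rep_def by (rule linear_ext_single[OF additive_rep])

lemma rep_zero: "rep 0 \<psi> = 0"
  by (simp add: rep_def linear_ext_zero)

lemma rep_add: "rep (A + B) \<psi> = rep A \<psi> + rep B \<psi>"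
  by (simp only: rep_def linear_ext_add[OF additive_rep])

lemma rep_diff: "rep (A - B) \<psi> = rep A \<psi> - rep B \<psi>"
  by (simp only: rep_def linear_ext_diff[OF additive_rep])

lemma rep_sum: "rep (sum A K) \<psi> = (\<Sum>k\<in>K. rep (A k) \<psi>)"
  by (simp only: rep_def linear_ext_sum[OF additive_rep])

lemma rep_add_vector: "rep A (\<phi> + \<psi>) = rep A \<phi> + rep A \<psi>"
  by (simp only: rep_def linear_ext_def hat_add distrib_left sum.distrib)

lemma rep_zero_vector: "rep A 0 = 0"
  by (simp only: rep_def linear_ext_def hat_zero mult_zero_right sum.neutral_const)

context fuzzy_cylinder
begin

lemma rep_scale: "A \<in> L \<Longrightarrow> rep (L_scale c A) \<psi> = (\<lambda>x. c * rep A \<psi> x)"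
proof (induction A rule: L_induct)
  case (add A B)
  thus ?case by (simp add: L_scale_add rep_add distrib_left fun_eq_iff)
qed (simp_all add: L_scale_zero L_scale_single rep_zero rep_single fun_eq_iff)

text \<open>
  On monomials this is the covariance relation: conjugating multiplication by \<open>g\<close> with transport
  along \<open>s\<close> gives multiplication by the transported function, and transport is functorial.
  Cutting off to the range of \<open>s\<close>, which conjugation entails, is absorbed by the factor \<open>f\<close>.
\<close>

lemma rep_mult:
  assumes "A \<in> L" "B \<in> L"
  shows "rep (L_mult A B) \<psi> = rep A (rep B \<psi>)"
  using assms
proof (induction A rule: L_induct)
  case zero
  show ?case by (simp add: L_mult_zero rep_zero)
next
  case (add A A')
  thus ?case by (simp add: L_mult_add_left rep_add)
next
  case (single s f)
  note s = single(1,2)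
  from single(3) show ?case
  proof (induction B rule: L_induct)
    case zero
    show ?case by (simp only: L_mult_zero rep_zero rep_zero_vector)
  next
    case (add B B')
    thus ?case by (simp only: L_mult_add_right rep_add rep_add_vector)
  next
    case (single t g)
    have "hat s (hat (pinv s) f * g) * hat (s \<circ>\<^sub>m t) \<psi> = f * hat s (g * hat t \<psi>)"
      using s single
      by (auto simp: hat_mult hat_comp S_pinj hat_hat_pinv hat_outside fun_eq_iff)
    thus ?case
      by (simp only: L_mult_single_single rep_single)
  qed
qed

text \<open>
  If \<open>s\<close> restricts \<open>t\<close>, then \<open>f\<close>, which lives on the range of \<open>s\<close>, cannot tell the
  transports along \<open>s\<close> and \<open>t\<close> apart.
\<close>

lemma rep_N: "A \<in> N \<Longrightarrow> rep A \<psi> = 0"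
proof -
  let ?J = "{A \<in> L. \<forall>\<psi>. rep A \<psi> = 0}"
  have "rep (L_scale c A) \<psi> = 0" if "A \<in> L" "rep A \<psi> = 0" for A c \<psi>
    using rep_scale[OF that(1), of c \<psi>] that(2) by (simp add: fun_eq_iff)
  hence "L_ideal I a F ?J"
    unfolding L_ideal_def
    by (simp add: L_zero L_add L_scale L_mult rep_zero rep_add rep_mult rep_zero_vector)
  moreover have "N_gens I a F \<subseteq> ?J"
  proof
    fix A assume A: "A \<in> N_gens I a F"
    then obtain s t f where *: "A = Poly_Mapping.single s f - Poly_Mapping.single t f" "s \<in> S" "t \<in> S"
        "s \<subseteq>\<^sub>m t" "f \<in> ideal_on F (ran s)"
      unfolding N_gens_def using semigroup_le_iff_map_le[OF pb] by blast
    have "f x * hat s \<psi> x = f x * hat t \<psi> x" for x \<psi>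
      using * hat_restriction[OF S_pinj, of t s x \<psi>] by (cases "x \<in> ran s") (auto simp: ideal_on_def)
    hence "rep A \<psi> = 0" for \<psi>
      unfolding *(1) rep_diff rep_single by (simp add: fun_eq_iff)
    with A N_gens_L show "A \<in> ?J" by auto
  qed
  ultimately show "A \<in> N \<Longrightarrow> rep A \<psi> = 0"
    using N_subset by blast
qed

lemma rep_cls: "B \<in> cls A \<Longrightarrow> rep B \<psi> = rep A \<psi>"
  using rep_N[of "B - A" \<psi>] by (simp add: mem_cls_iff rep_diff)

end

section \<open>Square summable functions\<close>

definition sq_norm :: "real set \<Rightarrow> (real \<Rightarrow> complex) \<Rightarrow> real" where
  "sq_norm X \<psi> = (\<Sum>\<^sub>\<infinity>x\<in>X. (cmod (\<psi> x))\<^sup>2)"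

lemma l2_norm_eq: "l2_norm X \<psi> = sqrt (sq_norm X \<psi>)"
  by (simp add: l2_norm_def sq_norm_def)

lemma cmod_add_sq_le: "(cmod (w + z))\<^sup>2 \<le> 2 * (cmod w)\<^sup>2 + 2 * (cmod z)\<^sup>2"
proof -
  have "(cmod (w + z))\<^sup>2 \<le> (cmod w + cmod z)\<^sup>2"
    by (intro power_mono norm_triangle_ineq) simp
  also have "\<dots> \<le> 2 * (cmod w)\<^sup>2 + 2 * (cmod z)\<^sup>2"
    using sum_squares_bound[of "cmod w" "cmod z"] by (simp add: power2_sum)
  finally show ?thesis .
qed

lemma l2_dominated:
  assumes "\<And>x. x \<notin> X \<Longrightarrow> \<psi> x = 0" "g summable_on X" "\<And>x. x \<in> X \<Longrightarrow> (cmod (\<psi> x))\<^sup>2 \<le> g x"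
  shows "\<psi> \<in> l2 X" "sq_norm X \<psi> \<le> infsum g X"
proof -
  have s: "(\<lambda>x. (cmod (\<psi> x))\<^sup>2) summable_on X"
    using assms(2,3) by (rule summable_on_comparison_test) auto
  with assms(1) show "\<psi> \<in> l2 X" by (simp add: l2_def)
  show "sq_norm X \<psi> \<le> infsum g X"
    unfolding sq_norm_def using s assms(2,3) by (rule infsum_mono)
qed

lemma l2_summable: "\<psi> \<in> l2 X \<Longrightarrow> (\<lambda>x. (cmod (\<psi> x))\<^sup>2) summable_on X"
  by (simp add: l2_def)

lemma l2_zero_outside: "\<psi> \<in> l2 X \<Longrightarrow> x \<notin> X \<Longrightarrow> \<psi> x = 0"
  by (simp add: l2_def)

lemma l2_zero: "0 \<in> l2 X"
  by (simp add: l2_def)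

lemma l2_add:
  assumes "\<phi> \<in> l2 X" "\<psi> \<in> l2 X"
  shows "\<phi> + \<psi> \<in> l2 X" "sq_norm X (\<phi> + \<psi>) \<le> 2 * sq_norm X \<phi> + 2 * sq_norm X \<psi>"
proof -
  let ?g = "\<lambda>x. 2 * (cmod (\<phi> x))\<^sup>2 + 2 * (cmod (\<psi> x))\<^sup>2"
  have s: "(\<lambda>x. 2 * (cmod (\<phi> x))\<^sup>2) summable_on X" "(\<lambda>x. 2 * (cmod (\<psi> x))\<^sup>2) summable_on X"
    using assms by (auto intro!: summable_on_cmult_right l2_summable)
  have z: "(\<phi> + \<psi>) x = 0" if "x \<notin> X" for x
    using assms that by (simp add: l2_def)
  have le: "(cmod ((\<phi> + \<psi>) x))\<^sup>2 \<le> ?g x" for x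
    using cmod_add_sq_le by simp
  show "\<phi> + \<psi> \<in> l2 X"
    by (rule l2_dominated(1)[OF z summable_on_add[OF s] le])
  have "sq_norm X (\<phi> + \<psi>) \<le> infsum ?g X"
    by (rule l2_dominated(2)[OF z summable_on_add[OF s] le])
  also have "\<dots> = 2 * sq_norm X \<phi> + 2 * sq_norm X \<psi>"
    using assms by (simp add: sq_norm_def infsum_add[OF s] infsum_cmult_right l2_summable)
  finally show "sq_norm X (\<phi> + \<psi>) \<le> 2 * sq_norm X \<phi> + 2 * sq_norm X \<psi>" .
qed

lemma l2_scale:
  assumes "\<psi> \<in> l2 X"
  shows "(\<lambda>x. c * \<psi> x) \<in> l2 X"
  using assms by (auto simp: l2_def norm_mult power_mult_distrib intro!: summable_on_cmult_right)

lemma l2_inner_summable: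
  assumes "\<phi> \<in> l2 X" "\<psi> \<in> l2 X"
  shows "(\<lambda>x. cnj (\<phi> x) * \<psi> x) summable_on X"
proof (rule abs_summable_summable, rule summable_on_comparison_test)
  show "(\<lambda>x. (cmod (\<phi> x))\<^sup>2 + (cmod (\<psi> x))\<^sup>2) summable_on X"
    using assms by (intro summable_on_add l2_summable)
  show "cmod (cnj (\<phi> x) * \<psi> x) \<le> (cmod (\<phi> x))\<^sup>2 + (cmod (\<psi> x))\<^sup>2" for x
  proof -
    have "2 * (cmod (\<phi> x) * cmod (\<psi> x)) \<le> (cmod (\<phi> x))\<^sup>2 + (cmod (\<psi> x))\<^sup>2"
      using sum_squares_bound[of "cmod (\<phi> x)" "cmod (\<psi> x)"] by simp
    moreover have "0 \<le> cmod (\<phi> x) * cmod (\<psi> x)" by simp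
    ultimately show ?thesis by (simp only: norm_mult complex_mod_cnj)
  qed
qed simp_all

text \<open>
  Boundedness is stated with squared norms, for which the elementary inequality
  \<open>\<bar>w + z\<bar>\<^sup>2 \<le> 2 \<bar>w\<bar>\<^sup>2 + 2 \<bar>z\<bar>\<^sup>2\<close> is enough to add operators. The map may be
  defined beyond the square summable functions, as the covariant action is.
\<close>

definition bounded_linear_l2 :: "real set \<Rightarrow> ((real \<Rightarrow> complex) \<Rightarrow> (real \<Rightarrow> complex)) \<Rightarrow> bool" where
  "bounded_linear_l2 X T \<longleftrightarrow>
     (\<forall>\<phi>\<in>l2 X. \<forall>\<psi>\<in>l2 X. T (\<phi> + \<psi>) = T \<phi> + T \<psi>) \<and>
     (\<forall>c. \<forall>\<psi>\<in>l2 X. T (\<lambda>x. c * \<psi> x) = (\<lambda>x. c * T \<psi> x)) \<and>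
     (\<exists>K\<ge>0. \<forall>\<psi>\<in>l2 X. T \<psi> \<in> l2 X \<and> sq_norm X (T \<psi>) \<le> K * sq_norm X \<psi>)"

lemma bounded_linear_l2_closed: "bounded_linear_l2 X T \<Longrightarrow> \<psi> \<in> l2 X \<Longrightarrow> T \<psi> \<in> l2 X"
  by (auto simp: bounded_linear_l2_def)

lemma restrict_bounded_operators:
  assumes "bounded_linear_l2 X T"
  shows "restrict T (l2 X) \<in> bounded_operators X"
proof -
  obtain K where K: "0 \<le> K" "\<And>\<psi>. \<psi> \<in> l2 X \<Longrightarrow> T \<psi> \<in> l2 X \<and> sq_norm X (T \<psi>) \<le> K * sq_norm X \<psi>"
    using assms by (auto simp: bounded_linear_l2_def)
  have "l2_norm X (T \<psi>) \<le> sqrt K * l2_norm X \<psi>" if "\<psi> \<in> l2 X" for \<psi>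
    unfolding l2_norm_eq real_sqrt_mult[symmetric] using K(2)[OF that] by (intro real_sqrt_le_mono) simp
  hence "\<exists>K. \<forall>\<psi>\<in>l2 X. l2_norm X (T \<psi>) \<le> K * l2_norm X \<psi>" by blast
  with assms K(2) show ?thesis
    by (auto simp: bounded_operators_def bounded_linear_l2_def l2_add l2_scale)
qed

lemma bounded_linear_l2_zero: "bounded_linear_l2 X (\<lambda>\<psi>. 0)"
  by (auto simp: bounded_linear_l2_def l2_zero sq_norm_def fun_eq_iff intro!: exI[of _ 0])

lemma bounded_linear_l2_add:
  assumes "bounded_linear_l2 X T" "bounded_linear_l2 X T'"
  shows "bounded_linear_l2 X (\<lambda>\<psi>. T \<psi> + T' \<psi>)"
proof -
  obtain K where K: "0 \<le> K" "\<And>\<psi>. \<psi> \<in> l2 X \<Longrightarrow> T \<psi> \<in> l2 X"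
      "\<And>\<psi>. \<psi> \<in> l2 X \<Longrightarrow> sq_norm X (T \<psi>) \<le> K * sq_norm X \<psi>"
    using assms(1) by (auto simp: bounded_linear_l2_def)
  obtain K' where K': "0 \<le> K'" "\<And>\<psi>. \<psi> \<in> l2 X \<Longrightarrow> T' \<psi> \<in> l2 X"
      "\<And>\<psi>. \<psi> \<in> l2 X \<Longrightarrow> sq_norm X (T' \<psi>) \<le> K' * sq_norm X \<psi>"
    using assms(2) by (auto simp: bounded_linear_l2_def)
  have "sq_norm X (T \<psi> + T' \<psi>) \<le> (2 * K + 2 * K') * sq_norm X \<psi>" if "\<psi> \<in> l2 X" for \<psi>
    using l2_add(2)[OF K(2)[OF that] K'(2)[OF that]] K(3)[OF that] K'(3)[OF that]
    by (simp add: distrib_right)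
  hence "\<exists>K\<ge>0. \<forall>\<psi>\<in>l2 X. T \<psi> + T' \<psi> \<in> l2 X \<and> sq_norm X (T \<psi> + T' \<psi>) \<le> K * sq_norm X \<psi>"
    using K(1,2) K'(1,2) by (intro exI[of _ "2 * K + 2 * K'"]) (auto simp: l2_add)
  moreover have "T (\<phi> + \<psi>) + T' (\<phi> + \<psi>) = (T \<phi> + T' \<phi>) + (T \<psi> + T' \<psi>)"
    if "\<phi> \<in> l2 X" "\<psi> \<in> l2 X" for \<phi> \<psi>
    using assms that by (simp add: bounded_linear_l2_def)
  moreover have "T (\<lambda>x. c * \<psi> x) + T' (\<lambda>x. c * \<psi> x) = (\<lambda>x. c * (T \<psi> + T' \<psi>) x)"
    if "\<psi> \<in> l2 X" for c \<psi>
    using assms that by (simp add: bounded_linear_l2_def distrib_left fun_eq_iff)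
  ultimately show ?thesis
    unfolding bounded_linear_l2_def by blast
qed

lemma bounded_linear_l2_comp:
  assumes "bounded_linear_l2 X T" "bounded_linear_l2 X T'"
  shows "bounded_linear_l2 X (\<lambda>\<psi>. T (T' \<psi>))"
proof -
  obtain K where K: "0 \<le> K" "\<And>\<psi>. \<psi> \<in> l2 X \<Longrightarrow> T \<psi> \<in> l2 X"
      "\<And>\<psi>. \<psi> \<in> l2 X \<Longrightarrow> sq_norm X (T \<psi>) \<le> K * sq_norm X \<psi>"
    using assms(1) by (auto simp: bounded_linear_l2_def)
  obtain K' where K': "0 \<le> K'" "\<And>\<psi>. \<psi> \<in> l2 X \<Longrightarrow> T' \<psi> \<in> l2 X"
      "\<And>\<psi>. \<psi> \<in> l2 X \<Longrightarrow> sq_norm X (T' \<psi>) \<le> K' * sq_norm X \<psi>"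
    using assms(2) by (auto simp: bounded_linear_l2_def)
  have "sq_norm X (T (T' \<psi>)) \<le> (K * K') * sq_norm X \<psi>" if "\<psi> \<in> l2 X" for \<psi>
    using K(3)[OF K'(2)[OF that]] mult_left_mono[OF K'(3)[OF that] K(1)] by (simp add: mult.assoc)
  hence "\<exists>K\<ge>0. \<forall>\<psi>\<in>l2 X. T (T' \<psi>) \<in> l2 X \<and> sq_norm X (T (T' \<psi>)) \<le> K * sq_norm X \<psi>"
    using K(1,2) K'(1,2) by (intro exI[of _ "K * K'"]) auto
  with assms K'(2) show ?thesis
    by (simp add: bounded_linear_l2_def)
qed

lemma bounded_linear_l2_mult:
  assumes "bounded (f ` X)"
  shows "bounded_linear_l2 X (\<lambda>\<psi>. f * \<psi>)"
proof -
  obtain B where B: "\<And>x. x \<in> X \<Longrightarrow> cmod (f x) \<le> B"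
    using assms by (auto simp: bounded_iff)
  have "f * \<psi> \<in> l2 X \<and> sq_norm X (f * \<psi>) \<le> B\<^sup>2 * sq_norm X \<psi>" if \<psi>: "\<psi> \<in> l2 X" for \<psi>
  proof -
    let ?g = "\<lambda>x. B\<^sup>2 * (cmod (\<psi> x))\<^sup>2"
    have "(f * \<psi>) x = 0" if "x \<notin> X" for x
      using \<psi> that by (simp add: l2_def)
    moreover have "?g summable_on X"
      using \<psi> by (intro summable_on_cmult_right l2_summable)
    moreover have "(cmod ((f * \<psi>) x))\<^sup>2 \<le> ?g x" if "x \<in> X" for x
      using power_mono[OF B[OF that], of 2] by (simp add: norm_mult power_mult_distrib mult_right_mono)
    ultimately have "f * \<psi> \<in> l2 X" "sq_norm X (f * \<psi>) \<le> infsum ?g X"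
      using l2_dominated[of X "f * \<psi>" ?g] by blast+
    thus ?thesis
      using \<psi> by (simp add: sq_norm_def infsum_cmult_right l2_summable)
  qed
  thus ?thesis
    unfolding bounded_linear_l2_def by (auto simp: distrib_left fun_eq_iff intro!: exI[of _ "B\<^sup>2"])
qed

definition stable_set :: "(real \<rightharpoonup> real) \<Rightarrow> real set \<Rightarrow> bool" where
  "stable_set s X \<longleftrightarrow> (\<forall>x y. s x = Some y \<longrightarrow> (x \<in> X \<longleftrightarrow> y \<in> X))"

text \<open>
  Substitution along \<open>s\<close>: it matches the part of \<open>X\<close> in the domain of \<open>s\<close> with the part in
  the range, and the remaining terms vanish.
\<close>

lemma has_sum_substitute:
  fixes G K :: "real \<Rightarrow> 'b::{comm_monoid_add, topological_space}"
  assumes s: "pinj s" "stable_set s X"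
    and G: "\<And>y. y \<notin> ran s \<Longrightarrow> G y = 0" and K: "\<And>x. x \<notin> dom s \<Longrightarrow> K x = 0"
    and GK: "\<And>x y. s x = Some y \<Longrightarrow> G y = K x"
  shows "(G has_sum v) X \<longleftrightarrow> (K has_sum v) X"
proof -
  have bij: "bij_betw (\<lambda>x. the (s x)) (X \<inter> dom s) (X \<inter> ran s)"
  proof (rule bij_betwI')
    show "(the (s x) = the (s y)) = (x = y)" if "x \<in> X \<inter> dom s" "y \<in> X \<inter> dom s" for x y
      using that pinj_D[OF s(1)] by fastforce
    show "the (s x) \<in> X \<inter> ran s" if "x \<in> X \<inter> dom s" for x
      using that s(2) by (auto simp: stable_set_def ran_def)
    show "\<exists>x\<in>X \<inter> dom s. y = the (s x)" if "y \<in> X \<inter> ran s" for y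
      using that s(2) by (force simp: stable_set_def ran_def)
  qed
  have "(G has_sum v) X \<longleftrightarrow> (G has_sum v) (X \<inter> ran s)"
    using G by (intro has_sum_cong_neutral) auto
  also have "\<dots> \<longleftrightarrow> ((\<lambda>x. G (the (s x))) has_sum v) (X \<inter> dom s)"
    by (rule has_sum_reindex_bij_betw[OF bij, symmetric])
  also have "\<dots> \<longleftrightarrow> (K has_sum v) X"
    using K GK by (intro has_sum_cong_neutral) auto
  finally show ?thesis .
qed

text \<open>
  Transport along \<open>s\<close> is a partial isometry: it preserves the mass carried by the domain of \<open>s\<close>
  and forgets the rest.
\<close>

lemma bounded_linear_l2_hat:
  assumes s: "pinj s" "stable_set s X"
  shows "bounded_linear_l2 X (hat s)"
proof -
  have "hat s \<psi> \<in> l2 X \<and> sq_norm X (hat s \<psi>) \<le> 1 * sq_norm X \<psi>" if \<psi>: "\<psi> \<in> l2 X" for \<psi>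
  proof -
    let ?G = "\<lambda>y. (cmod (hat s \<psi> y))\<^sup>2" and ?K = "\<lambda>x. if x \<in> dom s then (cmod (\<psi> x))\<^sup>2 else 0"
    have K: "?K summable_on X"
      using l2_summable[OF \<psi>] by (rule summable_on_comparison_test) auto
    hence "(?K has_sum infsum ?K X) X" by simp
    hence G: "(?G has_sum infsum ?K X) X"
      by (subst has_sum_substitute[OF s]) (auto simp: hat_outside hat_eq[OF s(1)])
    have "hat s \<psi> y = 0" if "y \<notin> X" for y
    proof (cases "y \<in> ran s")
      case True
      then obtain x where x: "s x = Some y" by (auto simp: ran_def)
      with s(2) that have "x \<notin> X" by (auto simp: stable_set_def)
      thus ?thesis by (simp add: hat_eq[OF s(1) x] l2_zero_outside[OF \<psi>])
    qed (rule hat_outside)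
    hence "hat s \<psi> \<in> l2 X"
      using G by (auto simp: l2_def summable_on_def)
    moreover have "sq_norm X (hat s \<psi>) = infsum ?K X"
      unfolding sq_norm_def using G by (rule infsumI)
    moreover have "infsum ?K X \<le> sq_norm X \<psi>"
      unfolding sq_norm_def using K l2_summable[OF \<psi>] by (rule infsum_mono) auto
    ultimately show ?thesis by simp
  qed
  thus ?thesis
    unfolding bounded_linear_l2_def by (auto simp: hat_add hat_scale intro!: exI[of _ 1])
qed

lemma adjoint_hat:
  assumes s: "pinj s" "stable_set s X"
  shows "adjoint_operators X (hat s) (hat (pinv s))"
  unfolding adjoint_operators_def
proof (intro ballI)
  fix \<phi> \<psi> :: "real \<Rightarrow> complex"
  have "((\<lambda>y. cnj (hat s \<phi> y) * \<psi> y) has_sum v) X \<longleftrightarrow> ((\<lambda>x. cnj (\<phi> x) * hat (pinv s) \<psi> x) has_sum v) X" for v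
  proof (rule has_sum_substitute[OF s])
    fix x y assume xy: "s x = Some y"
    hence "pinv s y = Some x" by (simp add: pinv_eq_Some_iff[OF s(1)])
    thus "cnj (hat s \<phi> y) * \<psi> y = cnj (\<phi> x) * hat (pinv s) \<psi> x"
      using hat_eq[OF s(1) xy] hat_eq[OF pinj_pinv[OF s(1)]] by simp
  qed (simp_all add: hat_outside ran_pinv[OF s(1)])
  thus "l2_inner X (hat s \<phi>) \<psi> = l2_inner X \<phi> (hat (pinv s) \<psi>)"
    unfolding l2_inner_def by (rule infsum_eqI')
qed

lemma adjoint_mult: "adjoint_operators X (\<lambda>\<psi>. f * \<psi>) (\<lambda>\<psi>. (\<lambda>x. cnj (f x)) * \<psi>)"
  by (simp add: adjoint_operators_def l2_inner_def mult.assoc mult.left_commute)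

lemma adjoint_comp:
  assumes "adjoint_operators X T T'" "adjoint_operators X U U'"
    and "bounded_linear_l2 X U" "bounded_linear_l2 X T'"
  shows "adjoint_operators X (\<lambda>\<psi>. T (U \<psi>)) (\<lambda>\<psi>. U' (T' \<psi>))"
  using assms by (simp add: adjoint_operators_def bounded_linear_l2_closed)

lemma adjoint_add:
  assumes "adjoint_operators X T T'" "adjoint_operators X U U'"
    and "bounded_linear_l2 X T" "bounded_linear_l2 X T'" "bounded_linear_l2 X U" "bounded_linear_l2 X U'"
  shows "adjoint_operators X (\<lambda>\<psi>. T \<psi> + U \<psi>) (\<lambda>\<psi>. T' \<psi> + U' \<psi>)"
  unfolding adjoint_operators_def
proof (intro ballI)
  fix \<phi> \<psi> assume *: "\<phi> \<in> l2 X" "\<psi> \<in> l2 X"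
  have "l2_inner X (T \<phi> + U \<phi>) \<psi> = l2_inner X (T \<phi>) \<psi> + l2_inner X (U \<phi>) \<psi>"
    using * assms by (simp add: l2_inner_def distrib_right infsum_add l2_inner_summable bounded_linear_l2_closed)
  moreover have "l2_inner X \<phi> (T' \<psi> + U' \<psi>) = l2_inner X \<phi> (T' \<psi>) + l2_inner X \<phi> (U' \<psi>)"
    using * assms by (simp add: l2_inner_def distrib_left infsum_add l2_inner_summable bounded_linear_l2_closed)
  ultimately show "l2_inner X (T \<phi> + U \<phi>) \<psi> = l2_inner X \<phi> (T' \<psi> + U' \<psi>)"
    using * assms(1,2) by (simp add: adjoint_operators_def)
qed

section \<open>The representation on an invariant set\<close>

locale invariant_set = fuzzy_cylinder +
  fixes X :: "real set"
  assumes X_I: "X \<subseteq> I"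
    and X_stable: "s \<in> gen_semigroup I a \<Longrightarrow> stable_set s X"
    and F_bounded: "f \<in> F \<Longrightarrow> bounded (f ` X)"
begin

lemma bounded_rep: "A \<in> L \<Longrightarrow> bounded_linear_l2 X (rep A)"
proof (induction A rule: L_induct)
  case zero
  have "rep 0 = (\<lambda>\<psi>. 0)"
    by (intro ext) (simp only: rep_zero)
  thus ?case
    by (simp only: bounded_linear_l2_zero)
next
  case (single s f)
  have "bounded_linear_l2 X (\<lambda>\<psi>. f * hat s \<psi>)"
    using bounded_linear_l2_comp[OF bounded_linear_l2_mult[OF F_bounded] bounded_linear_l2_hat]
      single X_stable S_pinj by (simp add: ideal_on_def)
  moreover have "rep (Poly_Mapping.single s f) = (\<lambda>\<psi>. f * hat s \<psi>)"
    by (rule ext) (rule rep_single)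
  ultimately show ?case by (simp only:)
next
  case (add A B)
  have "rep (A + B) = (\<lambda>\<psi>. rep A \<psi> + rep B \<psi>)"
    by (rule ext) (rule rep_add)
  with add show ?case
    by (simp only: bounded_linear_l2_add)
qed

lemma adjoint_rep: "A \<in> L \<Longrightarrow> adjoint_operators X (rep A) (rep (L_star A))"
proof (induction A rule: L_induct)
  case zero
  thus ?case
    by (simp add: adjoint_operators_def L_star_zero rep_zero l2_inner_def)
next
  case (single s f)
  have f: "f \<in> F" using single by (simp add: ideal_on_def)
  have "adjoint_operators X (\<lambda>\<psi>. f * hat s \<psi>) (\<lambda>\<psi>. hat (pinv s) ((\<lambda>x. cnj (f x)) * \<psi>))"
    using adjoint_comp[OF adjoint_mult adjoint_hat bounded_linear_l2_hat
        bounded_linear_l2_mult[OF F_bounded[OF F_cnj[OF f]]]]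
      single X_stable S_pinj by blast
  moreover have "rep (Poly_Mapping.single s f) = (\<lambda>\<psi>. f * hat s \<psi>)"
    by (rule ext) (rule rep_single)
  moreover have "rep (L_star (Poly_Mapping.single s f)) = (\<lambda>\<psi>. hat (pinv s) ((\<lambda>x. cnj (f x)) * \<psi>))"
    by (rule ext) (simp only: L_star_single rep_single hat_mult)
  ultimately show ?case by (simp only:)
next
  case (add A B)
  have "adjoint_operators X (\<lambda>\<psi>. rep A \<psi> + rep B \<psi>) (\<lambda>\<psi>. rep (L_star A) \<psi> + rep (L_star B) \<psi>)"
    using add by (intro adjoint_add bounded_rep L_star)
  moreover have "rep (A + B) = (\<lambda>\<psi>. rep A \<psi> + rep B \<psi>)" for A B
    by (rule ext) (rule rep_add)
  ultimately show ?case
    by (simp only: L_star_add)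
qed

text \<open>
  Any representative gives the same operator by \<open>rep_cls\<close>. Operators on \<open>l2 X\<close> are extensional
  functions, whence the restriction.
\<close>

definition \<Phi> :: "lelem set \<Rightarrow> (real \<Rightarrow> complex) \<Rightarrow> (real \<Rightarrow> complex)" where
  "\<Phi> c = restrict (rep (SOME A. A \<in> c)) (l2 X)"

lemma \<Phi>_cls: "\<Phi> (cls A) = restrict (rep A) (l2 X)"
proof -
  have "(SOME B. B \<in> cls A) \<in> cls A"
    using mem_cls_self by (rule someI)
  hence "rep (SOME B. B \<in> cls A) = rep A"
    by (intro ext rep_cls)
  thus ?thesis by (simp add: \<Phi>_def)
qed

lemma star_representation_\<Phi>: "star_representation I a F X \<Phi>"
proof -
  have 1: "\<Phi> (cls A) \<in> bounded_operators X" if "A \<in> L" for A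
    unfolding \<Phi>_cls by (intro restrict_bounded_operators bounded_rep that)
  have 2: "\<Phi> (Cyl_add I a F (cls A) (cls B)) \<psi> = \<Phi> (cls A) \<psi> + \<Phi> (cls B) \<psi>" if "\<psi> \<in> l2 X" for A B \<psi>
    using that by (simp add: Cyl_add_cls \<Phi>_cls rep_add)
  have 3: "\<Phi> (Cyl_scale I a F z (cls A)) \<psi> = (\<lambda>x. z * \<Phi> (cls A) \<psi> x)" if "A \<in> L" "\<psi> \<in> l2 X" for A z \<psi>
    using that by (simp add: Cyl_scale_cls \<Phi>_cls rep_scale)
  have 4: "\<Phi> (Cyl_mult I a F (cls A) (cls B)) \<psi> = \<Phi> (cls A) (\<Phi> (cls B) \<psi>)"
    if "A \<in> L" "B \<in> L" "\<psi> \<in> l2 X" for A B \<psi>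
    using that by (simp add: Cyl_mult_cls \<Phi>_cls rep_mult bounded_linear_l2_closed[OF bounded_rep])
  have 5: "adjoint_operators X (\<Phi> (cls A)) (\<Phi> (Cyl_star I a F (cls A)))" if "A \<in> L" for A
    using adjoint_rep[OF that] by (simp add: Cyl_star_cls \<Phi>_cls adjoint_operators_def)
  show ?thesis
    unfolding star_representation_def Cyl_def using 1 2 3 4 5 by blast
qed

abbreviation "V \<equiv> restrict (hat a) (l2 X)"
abbreviation "Vs \<equiv> restrict (hat (pinv a)) (l2 X)"
abbreviation "mult_op f \<equiv> restrict (\<lambda>\<psi>. f * \<psi>) (l2 X)"

lemma ppow_1: "ppow I a 1 = a"
  using ppow_Suc[of 0 I a] pb
  by (intro map_eqI) (auto simp: ppow_0 map_comp_Some_iff pid_eq_Some_iff partial_bij_def)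

lemma a_S: "a \<in> S"
  using gen_semigroup.power[of I a 1] by (simp add: ppow_1)

lemma a_pinj: "pinj a"
  by (rule S_pinj[OF a_S])

lemma bounded_hat: "s \<in> S \<Longrightarrow> bounded_linear_l2 X (hat s)"
  by (intro bounded_linear_l2_hat S_pinj X_stable)

lemma V_bounded: "V \<in> bounded_operators X" "Vs \<in> bounded_operators X"
  by (intro restrict_bounded_operators bounded_hat a_S S_pinv)+

lemma V_adjoint: "adjoint_operators X V Vs"
  using adjoint_hat[OF a_pinj X_stable[OF a_S]] by (simp add: adjoint_operators_def)

lemma mult_op_bounded: "f \<in> F \<Longrightarrow> mult_op f \<in> bounded_operators X"
  by (intro restrict_bounded_operators bounded_linear_l2_mult F_bounded)

lemma hat_pid: "\<psi> \<in> l2 X \<Longrightarrow> hat (pid I) \<psi> = \<psi>"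
  using X_I unfolding hat_def pinv_pid by (auto simp: fun_eq_iff pid_def restrict_map_def l2_def)

text \<open>
  The powers of \<open>a\<close> start from the identity of \<open>I\<close>, which acts trivially because \<open>X\<close> lies in \<open>I\<close>.
\<close>

lemma V_funpow:
  assumes "\<psi> \<in> l2 X"
  shows "(V ^^ n) \<psi> = hat (ppow I a (int n)) \<psi>" "(Vs ^^ n) \<psi> = hat (ppow I a (- int n)) \<psi>"
proof -
  have closed: "hat (ppow I a m) \<psi> \<in> l2 X" for m
    by (intro bounded_linear_l2_closed[OF bounded_hat] gen_semigroup.power assms)
  show "(V ^^ n) \<psi> = hat (ppow I a (int n)) \<psi>"
  proof (induction n)
    case 0
    show ?case by (simp add: ppow_0 hat_pid assms)
  next
    case (Suc n)
    have "ppow I a (int (Suc n)) = a \<circ>\<^sub>m ppow I a (int n)"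
      using ppow_Suc[of "int n" I a] by (simp add: add.commute)
    with Suc closed show ?case
      by (simp add: hat_comp a_pinj pinj_ppow)
  qed
  show "(Vs ^^ n) \<psi> = hat (ppow I a (- int n)) \<psi>"
  proof (induction n)
    case 0
    show ?case by (simp add: ppow_0 hat_pid assms)
  next
    case (Suc n)
    have "ppow I a (- int (Suc n)) = pinv a \<circ>\<^sub>m ppow I a (- int n)"
      using ppow_pred[of "- int n" I a] by (simp add: minus_diff_commute[of 1])
    with Suc closed show ?case
      by (simp add: hat_comp a_pinj pinj_ppow pinj_pinv)
  qed
qed

lemma \<Phi>_Cyl_sum:
  assumes f: "f \<in> coeff_families I a F" and \<psi>: "\<psi> \<in> l2 X"
  shows "\<Phi> (Cyl_sum I a F f) \<psi> =
      (\<Sum>n | 1 \<le> n \<and> - int n \<in> Poly_Mapping.keys f.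
         mult_op (Poly_Mapping.lookup f (- int n)) ((Vs ^^ n) \<psi>))
      + mult_op (Poly_Mapping.lookup f 0) \<psi>
      + (\<Sum>n | 1 \<le> n \<and> int n \<in> Poly_Mapping.keys f.
         mult_op (Poly_Mapping.lookup f (int n)) ((V ^^ n) \<psi>))"
proof -
  let ?K = "Poly_Mapping.keys f" and ?t = "\<lambda>n. Poly_Mapping.lookup f n * hat (ppow I a n) \<psi>"
  have closed: "hat (ppow I a m) \<psi> \<in> l2 X" for m
    by (intro bounded_linear_l2_closed[OF bounded_hat] gen_semigroup.power \<psi>)
  have "\<Phi> (Cyl_sum I a F f) \<psi> = (\<Sum>n\<in>?K. ?t n)"
    using \<psi> by (simp add: Cyl_sum_def \<Phi>_cls rep_sum rep_single)
  also have "\<dots> = (\<Sum>n\<in>insert 0 ?K. ?t n)"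
    by (rule sum.mono_neutral_left) (auto simp: in_keys_iff)
  also have "insert 0 ?K = {n\<in>?K. n < 0} \<union> ({0} \<union> {n\<in>?K. 0 < n})" by auto
  also have "(\<Sum>n\<in>\<dots>. ?t n) = (\<Sum>n\<in>{n\<in>?K. n < 0}. ?t n) + (?t 0 + (\<Sum>n\<in>{n\<in>?K. 0 < n}. ?t n))"
    by (subst sum.union_disjoint, auto)+
  also have "(\<Sum>n\<in>{n\<in>?K. n < 0}. ?t n) = (\<Sum>n | 1 \<le> n \<and> - int n \<in> ?K. ?t (- int n))"
    by (rule sum.reindex_bij_witness[of _ "\<lambda>n. - int n" "\<lambda>n. nat (- n)"]) auto
  also have "(\<Sum>n\<in>{n\<in>?K. 0 < n}. ?t n) = (\<Sum>n | 1 \<le> n \<and> int n \<in> ?K. ?t (int n))"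
    by (rule sum.reindex_bij_witness[of _ int nat]) auto
  finally have "\<Phi> (Cyl_sum I a F f) \<psi> =
      (\<Sum>n | 1 \<le> n \<and> - int n \<in> ?K. ?t (- int n)) + (?t 0 + (\<Sum>n | 1 \<le> n \<and> int n \<in> ?K. ?t (int n)))" .
  moreover have "mult_op (Poly_Mapping.lookup f (- int n)) ((Vs ^^ n) \<psi>) = ?t (- int n)"
    "mult_op (Poly_Mapping.lookup f (int n)) ((V ^^ n) \<psi>) = ?t (int n)" for n
    by (simp_all only: V_funpow[OF \<psi>] restrict_apply'[OF closed])
  moreover have "mult_op (Poly_Mapping.lookup f 0) \<psi> = ?t 0"
    by (simp only: restrict_apply'[OF \<psi>] ppow_0 hat_pid[OF \<psi>])
  ultimately show ?thesis
    by (simp only: add.assoc)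
qed

end


section \<open>Function algebras on the interval\<close>

lemma function_star_algebra_all: "function_star_algebra (all_funs I)"
  by (simp add: function_star_algebra_def all_funs_def)

lemma function_star_algebra_cont: "function_star_algebra (cont_funs I)"
  unfolding function_star_algebra_def cont_funs_def all_funs_def plus_fun_def times_fun_def zero_fun_def
  by (auto intro!: continuous_intros)

lemma C0_funsI:
  assumes "f \<in> cont_funs I"
    and "\<And>\<epsilon>. \<epsilon> > 0 \<Longrightarrow> \<exists>K\<subseteq>I. compact K \<and> (\<forall>x\<in>I - K. cmod (f x) < \<epsilon>)"
  shows "f \<in> C0_funs I"
  using assms by (simp add: C0_funs_def)

lemma C0_funsD:
  assumes "f \<in> C0_funs I" "\<epsilon> > 0"
  obtains K where "K \<subseteq> I" "compact K" "\<And>x. x \<in> I \<Longrightarrow> x \<notin> K \<Longrightarrow> cmod (f x) < \<epsilon>"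
  using assms by (auto simp: C0_funs_def)

lemma function_star_algebra_C0: "function_star_algebra (C0_funs I)"
proof -
  have cont: "f \<in> cont_funs I" if "f \<in> C0_funs I" for f
    using that by (simp add: C0_funs_def)
  note alg = function_star_algebra_cont[of I, unfolded function_star_algebra_def]
  have "0 \<in> C0_funs I"
    using alg by (intro C0_funsI) (auto intro!: exI[of _ "{}"])
  moreover have "f + g \<in> C0_funs I" if fg: "f \<in> C0_funs I" "g \<in> C0_funs I" for f g
  proof (rule C0_funsI)
    show "f + g \<in> cont_funs I" using alg fg cont by blast
    fix \<epsilon> :: real assume "\<epsilon> > 0"
    hence half: "\<epsilon> / 2 > 0" by simp
    obtain K where K: "K \<subseteq> I" "compact K" "\<And>x. x \<in> I \<Longrightarrow> x \<notin> K \<Longrightarrow> cmod (f x) < \<epsilon> / 2"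
      using C0_funsD[OF fg(1) half] by blast
    obtain K' where K': "K' \<subseteq> I" "compact K'" "\<And>x. x \<in> I \<Longrightarrow> x \<notin> K' \<Longrightarrow> cmod (g x) < \<epsilon> / 2"
      using C0_funsD[OF fg(2) half] by blast
    have "cmod ((f + g) x) < \<epsilon>" if "x \<in> I - (K \<union> K')" for x
      using norm_triangle_ineq[of "f x" "g x"] K(3)[of x] K'(3)[of x] that by auto
    thus "\<exists>K\<subseteq>I. compact K \<and> (\<forall>x\<in>I - K. cmod ((f + g) x) < \<epsilon>)"
      using K K' by (intro exI[of _ "K \<union> K'"]) auto
  qed
  moreover have "f * g \<in> C0_funs I" if fg: "f \<in> C0_funs I" "g \<in> C0_funs I" for f g
  proof (rule C0_funsI)
    show "f * g \<in> cont_funs I" using alg fg cont by blast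
    fix \<epsilon> :: real assume "\<epsilon> > 0"
    \<comment> \<open>Two factors below the square root have a product below \<open>\<epsilon>\<close>.\<close>
    hence root: "sqrt \<epsilon> > 0" by simp
    obtain K where K: "K \<subseteq> I" "compact K" "\<And>x. x \<in> I \<Longrightarrow> x \<notin> K \<Longrightarrow> cmod (f x) < sqrt \<epsilon>"
      using C0_funsD[OF fg(1) root] by blast
    obtain K' where K': "K' \<subseteq> I" "compact K'" "\<And>x. x \<in> I \<Longrightarrow> x \<notin> K' \<Longrightarrow> cmod (g x) < sqrt \<epsilon>"
      using C0_funsD[OF fg(2) root] by blast
    have "cmod ((f * g) x) < \<epsilon>" if "x \<in> I - (K \<union> K')" for x
    proof -
      have "cmod (f x) * cmod (g x) < sqrt \<epsilon> * sqrt \<epsilon>"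
        using K(3)[of x] K'(3)[of x] that by (intro mult_strict_mono') auto
      thus ?thesis using \<open>\<epsilon> > 0\<close> by (simp add: norm_mult)
    qed
    thus "\<exists>K\<subseteq>I. compact K \<and> (\<forall>x\<in>I - K. cmod ((f * g) x) < \<epsilon>)"
      using K K' by (intro exI[of _ "K \<union> K'"]) auto
  qed
  moreover have "(\<lambda>x. c * f x) \<in> C0_funs I" if f: "f \<in> C0_funs I" for f c
  proof (rule C0_funsI)
    show "(\<lambda>x. c * f x) \<in> cont_funs I" using alg f cont by blast
    fix \<epsilon> :: real assume "\<epsilon> > 0"
    \<comment> \<open>Adding \<open>1\<close> keeps the denominator positive when \<open>c = 0\<close>.\<close>
    hence pos: "\<epsilon> / (cmod c + 1) > 0" by (simp add: add_nonneg_pos)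
    obtain K where K: "K \<subseteq> I" "compact K" "\<And>x. x \<in> I \<Longrightarrow> x \<notin> K \<Longrightarrow> cmod (f x) < \<epsilon> / (cmod c + 1)"
      using C0_funsD[OF f pos] by blast
    have "cmod (c * f x) < \<epsilon>" if "x \<in> I - K" for x
    proof -
      have "cmod (c * f x) \<le> (cmod c + 1) * cmod (f x)"
        by (simp add: norm_mult mult_right_mono)
      also have "\<dots> < \<epsilon>"
        using K(3)[of x] that by (simp add: pos_less_divide_eq add_nonneg_pos mult.commute)
      finally show ?thesis .
    qed
    thus "\<exists>K\<subseteq>I. compact K \<and> (\<forall>x\<in>I - K. cmod (c * f x) < \<epsilon>)"
      using K by blast
  qed
  moreover have "(\<lambda>x. cnj (f x)) \<in> C0_funs I" if f: "f \<in> C0_funs I" for f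
  proof (rule C0_funsI)
    show "(\<lambda>x. cnj (f x)) \<in> cont_funs I" using alg f cont by blast
    show "\<exists>K\<subseteq>I. compact K \<and> (\<forall>x\<in>I - K. cmod (cnj (f x)) < \<epsilon>)" if "\<epsilon> > 0" for \<epsilon>
      using f that by (simp add: C0_funs_def)
  qed
  ultimately show ?thesis
    unfolding function_star_algebra_def by simp
qed

lemma C0_funs_bounded:
  assumes f: "f \<in> C0_funs I"
  shows "bounded (f ` I)"
proof -
  obtain K where K: "K \<subseteq> I" "compact K" "\<And>x. x \<in> I \<Longrightarrow> x \<notin> K \<Longrightarrow> cmod (f x) < 1"
    using C0_funsD[OF f zero_less_one] by blast
  have "continuous_on K f"
    using f K(1) by (auto simp: C0_funs_def cont_funs_def intro: continuous_on_subset)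
  hence "bounded (f ` K)"
    using K(2) compact_continuous_image compact_imp_bounded by blast
  moreover have "bounded (f ` (I - K))"
    using K(3) by (auto simp: bounded_iff intro!: exI[of _ 1] less_imp_le)
  ultimately have "bounded (f ` K \<union> f ` (I - K))" by simp
  thus ?thesis by (rule bounded_subset) auto
qed

lemma hat_all_funs:
  assumes a: "partial_bij I a" and s: "s \<in> gen_semigroup I a"
  shows "hat s f \<in> ideal_on (all_funs I) (ran s)"
proof -
  obtain n where "s \<subseteq>\<^sub>m ppow I a n"
    using gen_semigroup_le_ppow[OF a s] by blast
  hence "ran s \<subseteq> I"
    using ppow_ran_subset[OF a, of n] by (force simp: ran_def dest: map_leD)
  thus ?thesis
    by (auto simp: ideal_on_def all_funs_def intro!: hat_outside)
qed

section \<open>Orbits and the representation on them\<close>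

lemma orbitI: "ppow I a n x0 = Some y \<Longrightarrow> y \<in> orbit I a x0"
  by (force simp: orbit_def)

lemma orbitE:
  assumes "y \<in> orbit I a x0"
  obtains n where "ppow I a n x0 = Some y"
  using assms by (auto simp: orbit_def)

text \<open>
  A semigroup element restricts a power, and a power takes the orbit to itself. Applied to inverses
  this also shows that points outside the orbit stay outside.
\<close>

lemma orbit_forward:
  assumes a: "partial_bij I a" and s: "s \<in> gen_semigroup I a"
    and x: "x \<in> orbit I a x0" and xy: "s x = Some y"
  shows "y \<in> orbit I a x0"
proof -
  obtain n where n: "ppow I a n x0 = Some x" using x by (rule orbitE)
  obtain m where "s \<subseteq>\<^sub>m ppow I a m" using gen_semigroup_le_ppow[OF a s] by blast
  hence "(ppow I a m \<circ>\<^sub>m ppow I a n) x0 = Some y"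
    using n map_leD[of s "ppow I a m", OF _ xy] by (simp add: map_comp_Some_iff)
  thus ?thesis
    by (rule orbitI[OF map_leD[OF ppow_comp_le[OF a]]])
qed

lemma orbit_stable:
  assumes a: "partial_bij I a" and s: "s \<in> gen_semigroup I a"
  shows "stable_set s (orbit I a x0)"
  unfolding stable_set_def
  using orbit_forward[OF a s] orbit_forward[OF a gen_semigroup_pinv[OF a s]]
    pinv_eq_Some_iff[OF gen_semigroup_pinj[OF a s]] by blast

lemma ppow_dom_Suc_nonneg: "0 \<le> n \<Longrightarrow> x \<in> dom (ppow I a (n + 1)) \<Longrightarrow> x \<in> dom (ppow I a n)"
  by (auto simp: ppow_Suc map_comp_Some_iff)

lemma ppow_dom_nonneg:
  assumes "0 \<le> m" "m \<le> n" "x \<in> dom (ppow I a n)"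
  shows "x \<in> dom (ppow I a m)"
  using assms(2,3)
proof (induction n rule: int_ge_induct)
  case (step i)
  thus ?case using ppow_dom_Suc_nonneg[of i x I a] assms(1) by simp
qed

text \<open>
  The end is infinite or lies just below the first missing number. The negative half is treated by
  the same statement after a change of sign.
\<close>

lemma upper_end:
  fixes D :: "int set"
  assumes zero: "0 \<in> D" and down: "\<And>m n. 0 \<le> m \<Longrightarrow> m \<le> n \<Longrightarrow> n \<in> D \<Longrightarrow> m \<in> D"
  obtains p where "Fin 0 \<le> p" "\<And>n. 0 \<le> n \<Longrightarrow> n \<in> D \<longleftrightarrow> Fin n \<le> p"
proof (cases "\<forall>n\<ge>0. n \<in> D")
  case True
  thus ?thesis by (intro that[of Pinf]) auto
next
  case False
  then obtain k where "int k \<notin> D" by (metis nonneg_int_cases)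
  define m where "m = (LEAST k. int k \<notin> D)"
  have m: "int m \<notin> D"
    unfolding m_def using \<open>int k \<notin> D\<close> by (rule LeastI)
  have less: "int j \<in> D" if "j < m" for j
    using not_less_Least[of j "\<lambda>k. int k \<notin> D"] that by (auto simp: m_def)
  have "0 < m" using m zero by (cases m) auto
  show ?thesis
  proof (rule that[of "Fin (int m - 1)"])
    show "Fin 0 \<le> Fin (int m - 1)" using \<open>0 < m\<close> by simp
    show "n \<in> D \<longleftrightarrow> Fin n \<le> Fin (int m - 1)" if "0 \<le> n" for n
      using down[of "int m" n] m less[of "nat n"] that by force
  qed
qed

lemma ppow_domain_interval:
  assumes a: "partial_bij I a" and x0: "x0 \<in> I"
  obtains nm np :: "int extended" where "nm \<le> Fin 0" "Fin 0 \<le> np"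
    "\<And>n. x0 \<in> dom (ppow I a n) \<longleftrightarrow> nm \<le> Fin n \<and> Fin n \<le> np"
proof -
  have pa: "pinj a" using a by (simp add: partial_bij_def)
  define D where "D = {n. x0 \<in> dom (ppow I a n)}"
  have zero: "0 \<in> D"
    using x0 by (auto simp: D_def ppow_0 pid_eq_Some_iff dom_def)
  obtain p where p: "Fin 0 \<le> p" "\<And>n. 0 \<le> n \<Longrightarrow> n \<in> D \<longleftrightarrow> Fin n \<le> p"
    by (rule upper_end[of D]) (use zero ppow_dom_nonneg in \<open>auto simp: D_def\<close>)
  \<comment> \<open>The negative powers are the positive powers of the inverse.\<close>
  obtain q where q: "Fin 0 \<le> q" "\<And>n. 0 \<le> n \<Longrightarrow> - n \<in> D \<longleftrightarrow> Fin n \<le> q"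
  proof (rule upper_end[of "uminus ` D"])
    show "0 \<in> uminus ` D" using zero by force
    show "m \<in> uminus ` D" if "0 \<le> m" "m \<le> n" "n \<in> uminus ` D" for m n
    proof -
      have "x0 \<in> dom (ppow I (pinv a) n)"
        using that(3) by (auto simp: D_def ppow_pinv pa)
      hence "x0 \<in> dom (ppow I (pinv a) m)"
        by (rule ppow_dom_nonneg[OF that(1,2)])
      thus ?thesis
        by (force simp: D_def ppow_pinv pa intro: image_eqI[of _ _ "- m"])
    qed
  qed (force simp: image_iff)
  \<comment> \<open>The last case does not arise, since \<open>q\<close> is at least \<open>Fin 0\<close>.\<close>
  define nm where "nm = (case q of Fin k \<Rightarrow> Fin (- k) | Pinf \<Rightarrow> Minf | Minf \<Rightarrow> Pinf)"
  have nm: "nm \<le> Fin (- n) \<longleftrightarrow> Fin n \<le> q" for n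
    using q(1) by (cases q) (auto simp: nm_def)
  show ?thesis
  proof (rule that)
    show "nm \<le> Fin 0" using nm[of 0] q(1) by simp
    show "Fin 0 \<le> p" by (rule p)
    show "x0 \<in> dom (ppow I a n) \<longleftrightarrow> nm \<le> Fin n \<and> Fin n \<le> p" for n
    proof (cases "0 \<le> n")
      case True
      have "nm \<le> Fin n" using \<open>nm \<le> Fin 0\<close> True by (cases nm) auto
      with p(2)[OF True] show ?thesis by (simp add: D_def)
    next
      case False
      have "Fin n \<le> p" using p(1) False by (cases p) auto
      with q(2)[of "- n"] nm[of "- n"] False show ?thesis by (simp add: D_def)
    qed
  qed
qed

text \<open>
  Raising the exponent by one applies \<open>a\<close> also to negative powers: there the lower power is
  obtained from the higher one by the inverse of \<open>a\<close>, which injectivity lets one undo.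
\<close>

lemma ppow_step:
  assumes a: "partial_bij I a"
    and n: "ppow I a n x0 = Some y" and n1: "ppow I a (n + 1) x0 = Some z"
  shows "a y = Some z"
proof (cases "0 \<le> n")
  case True
  thus ?thesis using n n1 by (simp add: ppow_Suc)
next
  case False
  have pa: "pinj a" using a by (simp add: partial_bij_def)
  have "ppow I a n = pinv a \<circ>\<^sub>m ppow I a (n + 1)"
    using ppow_pred[of "n + 1" I a] False by simp
  thus ?thesis using n n1 by (simp add: pinv_eq_Some_iff[OF pa])
qed

lemma ppow_step_defined:
  assumes a: "partial_bij I a" and n: "ppow I a n x0 = Some y" and y: "a y = Some z"
  shows "ppow I a (n + 1) x0 = Some z"
proof -
  have "pinj a" using a by (simp add: partial_bij_def)
  from generator_comp_ppow_le[OF this] show ?thesis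
    by (rule map_leD) (use n y in \<open>simp add: map_comp_Some_iff\<close>)
qed

lemma hat_ket:
  assumes s: "pinj s"
  shows "hat s (ket x) = (case s x of Some y \<Rightarrow> ket y | None \<Rightarrow> 0)"
proof
  fix z
  show "hat s (ket x) z = (case s x of Some y \<Rightarrow> ket y | None \<Rightarrow> 0) z"
  proof (cases "z \<in> ran s")
    case True
    then obtain w where w: "s w = Some z" by (auto simp: ran_def)
    show ?thesis
      using w pinj_D[OF s, of x z w]
      by (auto simp: hat_eq[OF s w] ket_def indicator_def split: option.splits)
  next
    case False
    hence "s x \<noteq> Some z" by (auto simp: ran_def)
    thus ?thesis
      using False by (auto simp: hat_outside ket_def indicator_def split: option.splits)
  qed
qed

lemma ket_l2:
  assumes "x \<in> X"
  shows "ket x \<in> l2 X"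
proof -
  have "(\<lambda>y. (cmod (ket x y))\<^sup>2) summable_on {x}" by simp
  hence "(\<lambda>y. (cmod (ket x y))\<^sup>2) summable_on X"
    by (rule summable_on_cong_neutral[THEN iffD1, rotated -1])
      (use assms in \<open>auto simp: ket_def indicator_def\<close>)
  with assms show ?thesis by (auto simp: l2_def ket_def indicator_def)
qed

theorem proposition2p6:
  fixes I P :: "real set" and \<alpha> :: "real \<Rightarrow> (real \<rightharpoonup> real)" and h x0 :: real
    and F :: "(real \<Rightarrow> complex) set"
  assumes interval: "is_interval I"
    and family: "has_classical_limit I P \<alpha>"
    and h: "h \<in> P"
    and subintervals: "is_interval (dom (\<alpha> h))" "is_interval (ran (\<alpha> h))"
    and F: "F \<in> {all_funs I, cont_funs I, C0_funs I}"
    and ideals: "F \<noteq> all_funs I \<Longrightarrow>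
      \<forall>s\<in>gen_semigroup I (\<alpha> h). hat s ` ideal_on F (dom s) = ideal_on F (ran s)"
    and x0: "x0 \<in> I"
    and bounded_on_orbit: "F \<noteq> C0_funs I \<Longrightarrow> \<forall>f\<in>F. bounded (f ` orbit I (\<alpha> h) x0)"
  defines "x \<equiv> \<lambda>n::int. the (ppow I (\<alpha> h) n x0)"
    and "X \<equiv> orbit I (\<alpha> h) x0"
  shows "\<exists>nm np :: int extended.
    nm \<le> Fin 0 \<and> Fin 0 \<le> np \<and>
    (\<forall>n. x0 \<in> dom (ppow I (\<alpha> h) n) \<longleftrightarrow> nm \<le> Fin n \<and> Fin n \<le> np) \<and>
    X = {x n | n. nm \<le> Fin n \<and> Fin n \<le> np} \<and>
    (\<exists>V Vs \<pi>.
      V \<in> bounded_operators X \<and> Vs \<in> bounded_operators X \<and> adjoint_operators X V Vs \<and>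
      \<pi> \<in> F \<rightarrow> bounded_operators X \<and>
      (\<forall>n. nm \<le> Fin n \<and> Fin n \<le> np \<longrightarrow>
        V (ket (x n)) = (if Fin n < np then ket (x (n + 1)) else 0) \<and>
        Vs (ket (x n)) = (if nm < Fin n then ket (x (n - 1)) else 0) \<and>
        (\<forall>f\<in>F. \<pi> f (ket (x n)) = (\<lambda>y. f (x n) * ket (x n) y))) \<and>
      Cyl I (\<alpha> h) F = Cyl_sum I (\<alpha> h) F ` coeff_families I (\<alpha> h) F \<and>
      (\<exists>\<Phi>. star_representation I (\<alpha> h) F X \<Phi> \<and>
        (\<forall>f\<in>coeff_families I (\<alpha> h) F. \<forall>\<psi>\<in>l2 X.
          \<Phi> (Cyl_sum I (\<alpha> h) F f) \<psi> =
            (\<Sum>n | 1 \<le> n \<and> - int n \<in> Poly_Mapping.keys f.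
               \<pi> (Poly_Mapping.lookup f (- int n)) ((Vs ^^ n) \<psi>))
            + \<pi> (Poly_Mapping.lookup f 0) \<psi>
            + (\<Sum>n | 1 \<le> n \<and> int n \<in> Poly_Mapping.keys f.
               \<pi> (Poly_Mapping.lookup f (int n)) ((V ^^ n) \<psi>)))))"
proof -
  let ?a = "\<alpha> h"
  have a: "partial_bij I ?a"
    using family h by (simp add: has_classical_limit_def)
  have alg: "function_star_algebra F"
    using F function_star_algebra_all function_star_algebra_cont function_star_algebra_C0 by auto
  have hat: "hat s f \<in> ideal_on F (ran s)"
    if s: "s \<in> gen_semigroup I ?a" and f: "f \<in> ideal_on F (dom s)" for s f
    using hat_all_funs[OF a s] ideals s f by (cases "F = all_funs I") auto
  have X_I: "X \<subseteq> I"
  proof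
    fix y assume "y \<in> X"
    then obtain n where "ppow I ?a n x0 = Some y" unfolding X_def by (rule orbitE)
    thus "y \<in> I" using ppow_ran_subset[OF a, of n] by (auto simp: ran_def)
  qed
  have bdd: "bounded (f ` X)" if "f \<in> F" for f
    using that bounded_on_orbit C0_funs_bounded[of f I] bounded_subset image_mono[OF X_I]
    unfolding X_def by metis
  interpret invariant_set I ?a F X
    using a alg hat X_I bdd orbit_stable[OF a] by unfold_locales (simp_all add: X_def)
  obtain nm np :: "int extended" where ends: "nm \<le> Fin 0" "Fin 0 \<le> np"
    "\<And>n. x0 \<in> dom (ppow I ?a n) \<longleftrightarrow> nm \<le> Fin n \<and> Fin n \<le> np"
    using ppow_domain_interval[OF a x0] by blast
  have orbit: "X = {x n | n. nm \<le> Fin n \<and> Fin n \<le> np}"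
    unfolding X_def orbit_def x_def ends(3) ..
  have kets: "V (ket (x n)) = (if Fin n < np then ket (x (n + 1)) else 0) \<and>
      Vs (ket (x n)) = (if nm < Fin n then ket (x (n - 1)) else 0) \<and>
      (\<forall>f\<in>F. mult_op f (ket (x n)) = (\<lambda>y. f (x n) * ket (x n) y))"
    if n: "nm \<le> Fin n \<and> Fin n \<le> np" for n
  proof -
    have xn: "ppow I ?a n x0 = Some (x n)"
      using n ends(3)[of n] by (auto simp: x_def)
    have l2: "ket (x n) \<in> l2 X"
      using orbit n by (intro ket_l2) blast
    \<comment> \<open>The map is defined at \<open>x n\<close> exactly if the next exponent is admissible, and its inverse
      exactly if the previous one is.\<close>
    have "Fin n < np \<longleftrightarrow> Fin (n + 1) \<le> np" using n by (cases np) auto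
    moreover have "nm \<le> Fin (n + 1)" using n by (cases nm) auto
    ultimately have up: "Fin n < np \<longleftrightarrow> x0 \<in> dom (ppow I ?a (n + 1))"
      using ends(3) by simp
    have "nm < Fin n \<longleftrightarrow> nm \<le> Fin (n - 1)" using n by (cases nm) auto
    moreover have "Fin (n - 1) \<le> np" using n by (cases np) auto
    ultimately have down: "nm < Fin n \<longleftrightarrow> x0 \<in> dom (ppow I ?a (n - 1))"
      using ends(3) by simp
    have V: "?a (x n) = (if Fin n < np then Some (x (n + 1)) else None)"
    proof (cases "Fin n < np")
      case True
      hence "ppow I ?a (n + 1) x0 = Some (x (n + 1))" using up by (auto simp: x_def)
      with True ppow_step[OF a xn] show ?thesis by simp
    next
      case False
      hence "?a (x n) = None"
        using up ppow_step_defined[OF a xn] by (cases "?a (x n)") auto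
      with False show ?thesis by simp
    qed
    have Vs: "pinv ?a (x n) = (if nm < Fin n then Some (x (n - 1)) else None)"
    proof (cases "nm < Fin n")
      case True
      hence "ppow I ?a (n - 1) x0 = Some (x (n - 1))" using down by (auto simp: x_def)
      with True ppow_step[OF a this, of "x n"] xn show ?thesis
        by (simp add: pinv_eq_Some_iff[OF a_pinj])
    next
      case False
      have "ppow I ?a (n - 1) x0 = Some z" if "pinv ?a (x n) = Some z" for z
        using map_leD[OF pinv_generator_comp_ppow_le[OF a_pinj], of I n x0 z] xn that
        by (simp add: map_comp_Some_iff)
      with False down have "pinv ?a (x n) = None" by (cases "pinv ?a (x n)") auto
      with False show ?thesis by simp
    qed
    have "f * ket (x n) = (\<lambda>y. f (x n) * ket (x n) y)" for f
      by (auto simp: ket_def indicator_def fun_eq_iff)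
    with l2 show ?thesis
      by (simp add: hat_ket[OF a_pinj] hat_ket[OF pinj_pinv[OF a_pinj]] V Vs)
  qed
  show ?thesis
  proof (rule exI[of _ nm], rule exI[of _ np], intro conjI allI ends orbit,
      rule exI[of _ V], rule exI[of _ Vs], rule exI[of _ "\<lambda>f. mult_op f"],
      intro conjI exI[of _ \<Phi>] V_bounded V_adjoint)
    show "(\<lambda>f. mult_op f) \<in> F \<rightarrow> bounded_operators X" using mult_op_bounded by blast
    show "\<forall>n. nm \<le> Fin n \<and> Fin n \<le> np \<longrightarrow>
        V (ket (x n)) = (if Fin n < np then ket (x (n + 1)) else 0) \<and>
        Vs (ket (x n)) = (if nm < Fin n then ket (x (n - 1)) else 0) \<and>
        (\<forall>f\<in>F. mult_op f (ket (x n)) = (\<lambda>y. f (x n) * ket (x n) y))"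
      using kets by blast
    show "Cyl I ?a F = Cyl_sum I ?a F ` coeff_families I ?a F" by (rule Cyl_eq_sums)
    show "star_representation I ?a F X \<Phi>" by (rule star_representation_\<Phi>)
    show "\<forall>f\<in>coeff_families I ?a F. \<forall>\<psi>\<in>l2 X. \<Phi> (Cyl_sum I ?a F f) \<psi> =
        (\<Sum>n | 1 \<le> n \<and> - int n \<in> Poly_Mapping.keys f.
           mult_op (Poly_Mapping.lookup f (- int n)) ((Vs ^^ n) \<psi>))
        + mult_op (Poly_Mapping.lookup f 0) \<psi>
        + (\<Sum>n | 1 \<le> n \<and> int n \<in> Poly_Mapping.keys f.
           mult_op (Poly_Mapping.lookup f (int n)) ((V ^^ n) \<psi>))"
      using \<Phi>_Cyl_sum by blast
  qed
qed

end
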